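(* Let $n\ge1$ and let $m$ be a positive integer or half-integer. Let $\eta,\lambda$ be vectors of integers in $\mathcal A^{\tilde B_n}_m=\{(x_1,\dots,x_n): x_1>x_2>\dots>x_n>0,\ x_1+x_2<2m\}$. Then, as $k\to\infty$ with $k\equiv|\eta|+|\lambda|\pmod2$, the number of walks from $\eta$ to $\lambda$ with exactly $k$ standard steps staying in $\mathcal A^{\tilde B_n}_m$ is asymptotically $$\frac{4^{n^2}}{(2m)^n}\left(\frac{\sin\frac{n\pi}{m}}{\sin\frac{\pi}{2m}}\right)^k\prod_{1\le h<t\le n}\left(\sin\frac{\pi(\eta_h-\eta_t)}{2m}\sin\frac{\pi(\lambda_h-\lambda_t)}{2m}\sin\frac{\pi(\eta_h+\eta_t)}{2m}\sin\frac{\pi(\lambda_h+\lambda_t)}{2m}\right)\prod_{h=1}^n\left(\sin\frac{\pi\eta_h}{2m}\sin\frac{\pi\lambda_h}{2m}\right).$$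
   Context: A half-integer is an odd integer divided by $2$. For $\eta\in\mathbb R^n$, $|\eta|=\eta_1+\dots+\eta_n$. A walk with $k$ standard steps from $\eta$ to $\lambda$ is a sequence $p_0=\eta,\dots,p_k=\lambda$ with $p_i-p_{i-1}\in\{\pm e_1,\dots,\pm e_n\}$; it stays in $R$ if all $p_i\in R$. "Asymptotically $E$" means the ratio of the count to $E$ tends to $1$. *)

theory Defs
  imports
    "HOL-Analysis.Analysis"
    "HOL-Library.Landau_Symbols"
    "HOL-Number_Theory.Cong"
begin

text \<open>
  A vector \<open>(x\<^sub>1, \<dots>, x\<^sub>n)\<close> of \<open>n\<close>-dimensional real space is a function \<open>x :: nat \<Rightarrow> real\<close> that
  vanishes outside \<open>{1..n}\<close>. Differences and negation of vectors are the pointwise ones on functions.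
\<close>

definition real_space :: "nat \<Rightarrow> (nat \<Rightarrow> real) set" where
  "real_space n = {x. \<forall>i. i \<notin> {1..n} \<longrightarrow> x i = 0}"

definition unit_vec :: "nat \<Rightarrow> nat \<Rightarrow> real" where
  "unit_vec i = (\<lambda>j. if j = i then 1 else 0)"

definition standard_steps :: "nat \<Rightarrow> (nat \<Rightarrow> real) set" where
  "standard_steps n = (\<Union>i\<in>{1..n}. {unit_vec i, - unit_vec i})"

definition walks ::
    "nat \<Rightarrow> (nat \<Rightarrow> real) set \<Rightarrow> (nat \<Rightarrow> real) \<Rightarrow> (nat \<Rightarrow> real) \<Rightarrow> nat \<Rightarrow> (nat \<Rightarrow> real) list set" where
  "walks n R \<eta> \<mu> k =
     {p. length p = k + 1 \<and> p ! 0 = \<eta> \<and> p ! k = \<mu> \<and>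
         (\<forall>i\<in>{1..k}. p ! i - p ! (i - 1) \<in> standard_steps n) \<and>
         (\<forall>i\<le>k. p ! i \<in> R)}"

text \<open>
  For \<open>n = 1\<close> there is no second coordinate; here \<open>x 2 = 0\<close>, so the last condition reads
  \<open>x\<^sub>1 < 2m\<close> and the alcove is the open interval \<open>(0, 2m)\<close>.
\<close>

definition alcove_B :: "nat \<Rightarrow> real \<Rightarrow> (nat \<Rightarrow> real) set" where
  "alcove_B n m =
     {x \<in> real_space n. (\<forall>i\<in>{1..<n}. x i > x (i + 1)) \<and> x n > 0 \<and> x 1 + x 2 < 2 * m}"

definition half_integer :: "real \<Rightarrow> bool" where
  "half_integer x \<longleftrightarrow> (\<exists>j::int. odd j \<and> x = of_int j / 2)"

definition coord_sum :: "nat \<Rightarrow> (nat \<Rightarrow> int) \<Rightarrow> int" where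
  "coord_sum n \<eta> = (\<Sum>i=1..n. \<eta> i)"

definition real_vec :: "(nat \<Rightarrow> int) \<Rightarrow> nat \<Rightarrow> real" where
  "real_vec \<eta> = (\<lambda>i. of_int (\<eta> i))"

end

theory Submission
  imports Defs "Jordan_Normal_Form.Determinant"
begin

text \<open>
  Put \<open>M = 2m\<close>. For frequencies \<open>f\<^sub>1, \<dots>, f\<^sub>n\<close> in \<open>{1..<M}\<close> of the same parity, the function
  \<open>x \<mapsto> det (sin (\<pi> f\<^sub>j x\<^sub>i / M))\<close> is an eigenfunction of the step operator on the whole lattice, with
  eigenvalue \<open>\<Sum>\<^sub>j 2 cos (\<pi> f\<^sub>j / M)\<close>, and it vanishes on the walls of the alcove: equal parity makes
  all \<open>sin (\<pi> f\<^sub>j (M - a) / M)\<close> agree with \<open>sin (\<pi> f\<^sub>j a / M)\<close> up to one common sign. A lattice walk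
  cannot jump over a wall, so the number of walks is exactly a combination of \<open>k\<close>-th powers of these
  eigenvalues, once the case \<open>k = 0\<close> is checked by discrete orthogonality of sines.

  Since the cosine decreases on \<open>[0, \<pi>]\<close>, the largest eigenvalue belongs to the frequencies
  \<open>1, 3, \<dots>, 2n - 1\<close>. The substitution \<open>f \<mapsto> M - f\<close> gives the only other eigenvalue of this modulus, its
  negative, which contributes the same amount when \<open>k\<close> has the right parity. The dominant determinant is
  a Vandermonde determinant in \<open>2 cos (2\<pi> x\<^sub>i / M)\<close>, which yields the product of sines.
\<close>

section \<open>Determinants of sines\<close>

lemma det_eq_0_if_rows_eq:
  assumes "i < n" "i' < n" "i \<noteq> i'" "\<And>j. j < n \<Longrightarrow> F i j = F i' j"
  shows "det (mat n n (\<lambda>(i, j). F i j :: 'a :: comm_ring_1)) = 0"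
  by (rule det_identical_rows[of _ n i i']) (use assms in \<open>auto intro!: eq_vecI\<close>)

text \<open>Induction on the size. With its last row evaluated at a variable, the determinant is a
  polynomial of degree at most \<open>n\<close> whose coefficient at \<open>n\<close> is the smaller
  determinant and whose roots include the earlier nodes.\<close>

lemma det_monic_polys:
  fixes q :: "nat \<Rightarrow> 'a :: idom poly" and w :: "nat \<Rightarrow> 'a"
  assumes "\<And>j. degree (q j) = j" "\<And>j. coeff (q j) j = 1"
  shows "det (mat n n (\<lambda>(i, j). poly (q j) (w i))) = (\<Prod>j<n. \<Prod>i<j. w j - w i)"
proof (induction n)
  case 0
  then show ?case by simp
next
  case (Suc n)
  \<comment> \<open>The free variable \<open>z\<close> occurs in row \<open>n\<close> only, so the
    cofactors of that row are constants and expanding along it yields the polynomial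
    \<open>P\<close>.\<close>
  define B where "B z = mat (Suc n) (Suc n) (\<lambda>(i, j). poly (q j) (if i = n then z else w i))" for z
  define C where "C j = cofactor (B 0) n j" for j
  define P where "P = (\<Sum>j<Suc n. Polynomial.smult (C j) (q j))"
  define D where "D = (\<Prod>j<n. \<Prod>i<j. w j - w i)"
  have cof: "cofactor (B z) n j = C j" for z j
    unfolding C_def cofactor_def
    by (intro arg_cong2[where f = "(*)"] arg_cong[where f = det] refl eq_matI)
       (auto simp: mat_delete_def B_def)
  have PB: "poly P z = det (B z)" for z
  proof -
    have "det (B z) = (\<Sum>j<Suc n. B z $$ (n, j) * cofactor (B z) n j)"
      by (rule laplace_expansion_row) (auto simp: B_def)
    also have "\<dots> = (\<Sum>j<Suc n. poly (q j) z * C j)"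
      unfolding cof by (intro sum.cong refl) (auto simp: B_def)
    also have "\<dots> = poly P z" unfolding P_def by (simp add: poly_sum mult.commute)
    finally show ?thesis ..
  qed
  have "C n = D"
  proof -
    have "C n = det (mat_delete (B 0) n n)" by (simp add: C_def cofactor_def)
    also have "mat_delete (B 0) n n = mat n n (\<lambda>(i, j). poly (q j) (w i))"
      by (intro eq_matI) (auto simp: mat_delete_def B_def)
    finally show ?thesis by (simp add: Suc D_def)
  qed
  have "det (B (w n)) = D * (\<Prod>i<n. w n - w i)"
  proof (cases "inj_on w {..<n}")
    case True
    define Q where "Q = Polynomial.smult D (\<Prod>i<n. [:- w i, 1:])"
    \<comment> \<open>Degree at most \<open>n\<close>, equal coefficients at \<open>n\<close> and
      agreement at \<open>n\<close> distinct nodes determine the polynomial.\<close>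
    have "P = Q"
    proof (rule poly_eqI_degree_lead_coeff[where A = "w ` {..<n}" and n = n])
      fix x assume "x \<in> w ` {..<n}"
      then obtain i where i: "i < n" "x = w i" by auto
      have "det (B x) = 0" unfolding B_def
        by (rule det_eq_0_if_rows_eq[of i _ n]) (use i in auto)
      moreover have "poly Q x = 0" using i by (auto simp: Q_def poly_prod)
      ultimately show "poly P x = poly Q x" by (simp add: PB)
    next
      show "n \<le> card (w ` {..<n})" using True by (simp add: card_image)
    next
      show "degree P \<le> n" unfolding P_def
        by (intro degree_sum_le order.trans[OF degree_smult_le]) (auto simp: assms)
    next
      show "degree Q \<le> n" unfolding Q_def
        by (intro order.trans[OF degree_smult_le] order.trans[OF degree_prod_sum_le]) auto
    next
      have "coeff (q j) n = 0" if "j < n" for j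
        using that by (simp add: coeff_eq_0 assms)
      then have "coeff P n = C n" unfolding P_def by (simp add: coeff_sum assms)
      moreover have "degree (\<Prod>i<n. [:- w i, 1:]) = n" 
        by (subst degree_prod_eq_sum_degree) auto
      then have "coeff (\<Prod>i<n. [:- w i, 1:]) n = 1"
        using lead_coeff_prod[of "\<lambda>i. [:- w i, 1:]" "{..<n}"] by simp
      ultimately show "coeff P n = coeff Q n" using \<open>C n = D\<close> by (simp add: Q_def)
    qed
    then show ?thesis using PB[of "w n"] by (simp add: Q_def poly_prod)
  next
    case False
    \<comment> \<open>Coinciding nodes annihilate both sides: the matrix has two equal rows and
      \<open>D\<close> has a zero factor.\<close>
    then obtain i i' where i: "i < n" "i' < i" "w i = w i'"
      by (auto simp: inj_on_def) (metis nat_neq_iff)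
    have "det (B (w n)) = 0" unfolding B_def
      by (rule det_eq_0_if_rows_eq[of i _ i']) (use i in auto)
    moreover have "D = 0" unfolding D_def using i by force
    ultimately show ?thesis by simp
  qed
  moreover have "B (w n) = mat (Suc n) (Suc n) (\<lambda>(i, j). poly (q j) (w i))"
    by (intro eq_matI) (auto simp: B_def)
  ultimately show ?case by (simp add: D_def)
qed

text \<open>The quotient \<open>sin ((2 * j + 1) * y) / sin y\<close> as a polynomial in
  \<open>2 * cos (2 * y)\<close>: Chebyshev polynomials of the fourth kind, in the rescaled variable
  that makes them monic.\<close>

fun sine_ratio_poly :: "nat \<Rightarrow> real poly" where
  "sine_ratio_poly 0 = 1"
| "sine_ratio_poly (Suc 0) = [:1, 1:]"
| "sine_ratio_poly (Suc (Suc j)) = pCons 0 (sine_ratio_poly (Suc j)) - sine_ratio_poly j"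

lemma degree_sine_ratio_poly:
  "degree (sine_ratio_poly j) = j \<and> coeff (sine_ratio_poly j) j = 1"
proof (induction j rule: sine_ratio_poly.induct)
  case (3 j)
  have *: "coeff (sine_ratio_poly (Suc (Suc j))) (Suc (Suc j)) = 1"
    using 3 by (simp add: coeff_eq_0)
  moreover have "degree (sine_ratio_poly (Suc (Suc j))) \<le> Suc (Suc j)"
    using 3 by (auto intro!: degree_diff_le order.trans[OF degree_pCons_le])
  ultimately show ?case by (metis le_antisym le_degree zero_neq_one)
qed auto

lemma sin_odd_multiple:
  "sin (real (2 * j + 1) * y) = sin y * poly (sine_ratio_poly j) (2 * cos (2 * y))"
proof (induction j rule: sine_ratio_poly.induct)
  case 2
  have c: "cos (2 * y) = 2 * (cos y * cos y) - 1" by (simp add: cos_double_cos power2_eq_square)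
  have "sin (3 * y) = sin (2 * y + y)" by (simp add: algebra_simps)
  also have "\<dots> = sin y * (1 + 2 * cos (2 * y))"
    unfolding sin_add sin_double c by (simp add: algebra_simps)
  finally show ?case by simp
next
  case (3 j)
  \<comment> \<open>The mean of the two frequencies is \<open>2 * j + 3\<close> and half their
    difference is \<open>2\<close>, so sum-to-product is exactly the recursion.\<close>
  have "sin (real (2 * Suc (Suc j) + 1) * y) + sin (real (2 * j + 1) * y) 
        = 2 * sin ((real (2 * Suc (Suc j) + 1) * y + real (2 * j + 1) * y) / 2)
          * cos ((real (2 * Suc (Suc j) + 1) * y - real (2 * j + 1) * y) / 2)"
    by (rule sin_plus_sin)
  also have "(real (2 * Suc (Suc j) + 1) * y + real (2 * j + 1) * y) / 2 = real (2 * Suc j + 1) * y"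
    by (simp add: field_simps)
  also have "(real (2 * Suc (Suc j) + 1) * y - real (2 * j + 1) * y) / 2 = 2 * y"
    by (simp add: field_simps)
  finally have "sin (real (2 * Suc (Suc j) + 1) * y)
        = 2 * cos (2 * y) * sin (real (2 * Suc j + 1) * y) - sin (real (2 * j + 1) * y)"
    by (simp only: eq_diff_eq mult_ac)
  then show ?case using 3 by (simp add: algebra_simps)
qed simp

lemma cos_double_diff: "2 * cos (2 * b) - 2 * cos (2 * a) = 4 * (sin (a + b) * sin (a - b))"
  for a b :: real
  by (simp add: sin_times_sin)

lemma det_mat_leibniz:
  "det (mat n n (\<lambda>(i, j). F i j :: 'a :: comm_ring_1))
    = (\<Sum>p | p permutes {..<n}. signof p * (\<Prod>i<n. F i (p i)))"
proof -
  have "det (mat n n (\<lambda>(i, j). F i j))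
      = (\<Sum>p | p permutes {0..<n}. signof p * (\<Prod>i = 0..<n. mat n n (\<lambda>(i, j). F i j) $$ (i, p i)))"
    by (rule det_def') simp
  also have "\<dots> = (\<Sum>p | p permutes {0..<n}. signof p * (\<Prod>i = 0..<n. F i (p i)))"
  proof (intro sum.cong refl arg_cong2[where f = "(*)"] prod.cong)
    fix p i assume "p \<in> {p. p permutes {0..<n}}" "i \<in> {0..<n}"
    then show "mat n n (\<lambda>(i, j). F i j) $$ (i, p i) = F i (p i)"
      using permutes_in_image[of p "{0..<n}" i] by simp
  qed
  finally show ?thesis by (simp only: atLeast0LessThan)
qed

lemma det_scale_rows:
  "det (mat n n (\<lambda>(i, j). c i * F i j :: 'a :: comm_ring_1)) = (\<Prod>i<n. c i) * det (mat n n (\<lambda>(i, j). F i j))"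
  unfolding det_mat_leibniz sum_distrib_left prod.distrib by (simp only: mult.left_commute)

text \<open>Factoring \<open>sin (y i)\<close> out of row \<open>i\<close> leaves monic polynomials
  evaluated at \<open>2 * cos (2 * y i)\<close>, hence a Vandermonde determinant; each difference of
  nodes splits into two sines.\<close>

lemma det_sin_odd_multiples:
  fixes y :: "nat \<Rightarrow> real"
  shows "det (mat n n (\<lambda>(i, j). sin (real (2 * j + 1) * y i)))
    = (\<Prod>i<n. sin (y i)) * (\<Prod>j<n. \<Prod>i<j. 4 * (sin (y i + y j) * sin (y i - y j)))"
  unfolding sin_odd_multiple det_scale_rows
  by (subst det_monic_polys[where w = "\<lambda>i. 2 * cos (2 * y i)"])
     (simp_all add: degree_sine_ratio_poly cos_double_diff)

section \<open>Telescoping sums of cosines\<close>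

lemma sum_cos_odd_multiples:
  "(\<Sum>i<n. 2 * cos (real (2 * i + 1) * x)) * sin x = sin (2 * real n * x)" for x :: real
proof (induction n)
  case (Suc n)
  have "sin (2 * real (Suc n) * x) - sin (2 * real n * x)
        = 2 * sin ((2 * real (Suc n) * x - 2 * real n * x) / 2) * cos ((2 * real (Suc n) * x + 2 * real n * x) / 2)"
    by (rule sin_diff_sin)
  also have "(2 * real (Suc n) * x - 2 * real n * x) / 2 = x" by (simp add: field_simps)
  also have "(2 * real (Suc n) * x + 2 * real n * x) / 2 = real (2 * n + 1) * x" by (simp add: field_simps)
  finally have "2 * cos (real (2 * n + 1) * x) * sin x = sin (2 * real (Suc n) * x) - sin (2 * real n * x)"
    by simp
  with Suc show ?case by (simp add: algebra_simps)
qed simp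

lemma sum_cos_multiples:
  "2 * sin (x / 2) * (\<Sum>f<M. cos (real f * x)) = sin ((real M - 1 / 2) * x) + sin (x / 2)" for x :: real
proof (induction M)
  case (Suc M)
  have "2 * sin (x / 2) * cos (real M * x) = sin ((real (Suc M) - 1 / 2) * x) - sin ((real M - 1 / 2) * x)"
    by (simp add: sin_diff_sin algebra_simps)
  with Suc show ?case by (simp add: algebra_simps)
qed simp

section \<open>Eigenfunctions of the step operator\<close>

definition sine :: "nat \<Rightarrow> nat \<Rightarrow> int \<Rightarrow> real" where
  "sine M r a = sin (pi * real r * of_int a / real M)"

lemma sine_0 [simp]: "sine M 0 a = 0" "sine M r 0 = 0"
  by (simp_all add: sine_def)

lemma sine_size [simp]: "M > 0 \<Longrightarrow> sine M r (int M) = 0"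
  by (simp add: sine_def)

text \<open>Here the sign depends on the coordinate \<open>a\<close> alone, so reflecting all
  frequencies merely rescales the rows of a determinant.\<close>

lemma sine_diff_index:
  assumes "f \<le> M" "M > 0"
  shows "sine M (M - f) a = (if even a then - 1 else 1) * sine M f a"
proof -
  have "pi * real (M - f) * of_int a / real M = pi * of_int a - pi * real f * of_int a / real M"
    using assms by (simp add: of_nat_diff field_simps)
  then show ?thesis unfolding sine_def by (simp add: sin_diff)
qed

text \<open>Here the sign depends on the parity of \<open>f\<close> alone, so frequencies of one
  parity see the reflection of a coordinate as one common sign.\<close>

lemma sine_diff_arg:
  assumes "M > 0"
  shows "sine M f (int M - a) = (if even f then - 1 else 1) * sine M f a"
proof -
  have "pi * real f * of_int (int M - a) / real M = pi * of_int (int f) - pi * real f * of_int a / real M"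
    using assms by (simp add: field_simps)
  then show ?thesis unfolding sine_def by (simp only: sin_diff sin_npi_int cos_npi_int) simp
qed

lemma sine_neighbours:
  "sine M f (a + 1) + sine M f (a - 1) = 2 * cos (pi * real f / real M) * sine M f a"
proof -
  have "pi * real f * of_int (a + 1) / real M = pi * real f * of_int a / real M + pi * real f / real M"
    "pi * real f * of_int (a - 1) / real M = pi * real f * of_int a / real M - pi * real f / real M"
    by (simp_all add: algebra_simps add_divide_distrib diff_divide_distrib)
  then show ?thesis unfolding sine_def by (simp only: sin_add sin_diff) (simp add: algebra_simps)
qed

text \<open>The bound on \<open>x\<close> keeps the half angle away from multiples of
  \<open>pi\<close>, so the Dirichlet kernel formula can be divided by its sine.\<close>

lemma sum_cos_multiples_int:
  fixes x :: int
  assumes "x \<noteq> 0" "\<bar>x\<bar> < 2 * int M"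
  shows "(\<Sum>f<M. cos (real f * (pi * of_int x / real M))) = (if even x then 0 else 1)"
proof -
  let ?\<phi> = "pi * of_int x / real M"
  have M: "M > 0" using assms by auto
  have "sin (?\<phi> / 2) \<noteq> 0"
  proof
    assume "sin (?\<phi> / 2) = 0"
    then obtain i :: int where "?\<phi> / 2 = of_int i * pi" by (auto simp: sin_zero_iff_int2)
    then have "real_of_int x = of_int (2 * int M * i)" using M by (simp add: field_simps)
    then have "x = 2 * int M * i" by (simp only: of_int_eq_iff)
    then show False using assms M by (cases "i = 0") (auto simp: abs_mult)
  qed
  \<comment> \<open>The first sine of the kernel formula becomes \<open>sin (?\<phi> / 2)\<close> up
    to sign: it cancels the second one for even \<open>x\<close> and doubles it for odd
    \<open>x\<close>.\<close>
  moreover have "(real M - 1 / 2) * ?\<phi> = pi * of_int x - ?\<phi> / 2"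
    using M by (simp add: field_simps)
  then have "2 * sin (?\<phi> / 2) * (\<Sum>f<M. cos (real f * ?\<phi>))
      = 2 * sin (?\<phi> / 2) * (if even x then 0 else 1)"
    unfolding sum_cos_multiples by (simp only: sin_diff sin_npi_int cos_npi_int) simp
  ultimately show ?thesis by (simp only: mult_cancel_left) simp
qed

text \<open>The product formula leaves cosine sums for \<open>a - b\<close> and
  \<open>a + b\<close>. These integers have the same parity, so the sums cancel unless
  \<open>a = b\<close>, where the first one is \<open>M\<close> and the second is zero.\<close>

lemma sine_orthogonal:
  assumes "0 < a" "a < int M" "0 < b" "b < int M"
  shows "(\<Sum>f<M. sine M f a * sine M f b) = (if a = b then real M / 2 else 0)"
proof -
  have "(\<Sum>f<M. sine M f a * sine M f b)
    = ((\<Sum>f<M. cos (real f * (pi * of_int (a - b) / real M)))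
      - (\<Sum>f<M. cos (real f * (pi * of_int (a + b) / real M)))) / 2"
    unfolding sum_subtractf[symmetric] sum_divide_distrib sine_def sin_times_sin
    by (intro sum.cong refl)
       (simp add: algebra_simps add_divide_distrib diff_divide_distrib)
  also have "\<dots> = (if a = b then real M / 2 else 0)"
  proof (cases "a = b")
    case True
    then show ?thesis using assms sum_cos_multiples_int[of "a + b" M] by simp
  next
    case False
    then show ?thesis
      using assms sum_cos_multiples_int[of "a + b" M] sum_cos_multiples_int[of "a - b" M] by simp
  qed
  finally show ?thesis .
qed

definition freqs :: "nat \<Rightarrow> bool \<Rightarrow> nat set" where
  "freqs M e = {f \<in> {1..<M}. even f = e}"

lemma finite_freqs [simp]: "finite (freqs M e)"
  by (simp add: freqs_def)

lemma sum_sine_freqs: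
  assumes "0 < a" "a < int M" "0 < b" "b < int M"
  shows "(\<Sum>f\<in>freqs M e. sine M f a * sine M f b)
    = real M / 4 * ((if a = b then 1 else 0) + (if e then - 1 else 1) * (if a + b = int M then 1 else 0))"
proof -
  have M: "M > 0" using assms by simp
  have "(\<Sum>f\<in>freqs M e. sine M f a * sine M f b)
      = (\<Sum>f<M. if even f = e then sine M f a * sine M f b else 0)"
    unfolding freqs_def by (rule sum.mono_neutral_cong_left) (auto simp: Suc_le_eq intro!: gr0I)
  \<comment> \<open>Averaging with the signed reflection of \<open>b\<close> projects onto the
    frequencies of parity \<open>e\<close>; orthogonality at \<open>int M - b\<close> then produces
    the term for \<open>a + b = int M\<close>.\<close>
  also have "\<dots> = (\<Sum>f<M. (sine M f a * sine M f b
      + (if e then - 1 else 1) * (sine M f a * sine M f (int M - b))) / 2)"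
    by (intro sum.cong refl) (auto simp: sine_diff_arg M)
  also have "\<dots> = ((\<Sum>f<M. sine M f a * sine M f b)
      + (if e then - 1 else 1) * (\<Sum>f<M. sine M f a * sine M f (int M - b))) / 2"
    by (simp only: sum_divide_distrib[symmetric] sum.distrib sum_distrib_left)
  also have "\<dots> = real M / 4 * ((if a = b then 1 else 0) + (if e then - 1 else 1) * (if a + b = int M then 1 else 0))"
    using assms sine_orthogonal[of a M b] sine_orthogonal[of a M "int M - b"]
    by (simp add: eq_diff_eq)
  finally show ?thesis .
qed

text \<open>The coordinates of a vector are numbered from \<open>1\<close>, the rows and columns of a matrix from \<open>0\<close>.\<close>
definition sine_det :: "nat \<Rightarrow> nat \<Rightarrow> (nat \<Rightarrow> nat) \<Rightarrow> (nat \<Rightarrow> int) \<Rightarrow> real" where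
  "sine_det M n f x = det (mat n n (\<lambda>(i, j). sine M (f j) (x (Suc i))))"

lemma sine_det_leibniz:
  "sine_det M n f x
    = (\<Sum>p | p permutes {..<n}. signof p * (\<Prod>i<n. sine M (f (p i)) (x (Suc i))))"
  unfolding sine_det_def det_mat_leibniz ..

section \<open>The eigenvalue equation\<close>

definition eigenvalue :: "nat \<Rightarrow> nat \<Rightarrow> (nat \<Rightarrow> nat) \<Rightarrow> real" where
  "eigenvalue M n f = (\<Sum>i<n. 2 * cos (pi * real (f i) / real M))"

lemma eigenvalue_permute: "p permutes {..<n} \<Longrightarrow> eigenvalue M n (f \<circ> p) = eigenvalue M n f"
  unfolding eigenvalue_def
  using sum.permute[of p "{..<n}" "\<lambda>i. 2 * cos (pi * real (f i) / real M)"] by (simp add: comp_def)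

lemma sum_neighbours_prod_sine:
  "(\<Sum>i<n. (\<Prod>j<n. sine M (f j) ((x(Suc i := x (Suc i) + 1)) (Suc j)))
        + (\<Prod>j<n. sine M (f j) ((x(Suc i := x (Suc i) - 1)) (Suc j))))
    = eigenvalue M n f * (\<Prod>j<n. sine M (f j) (x (Suc j)))"
  unfolding eigenvalue_def sum_distrib_right
proof (intro sum.cong refl)
  fix i assume i: "i \<in> {..<n}"
  have *: "(\<Prod>j<n. sine M (f j) ((x(Suc i := v)) (Suc j)))
      = sine M (f i) v * (\<Prod>j\<in>{..<n} - {i}. sine M (f j) (x (Suc j)))" for v
    unfolding prod.remove[OF finite_lessThan i] by (intro arg_cong2[where f = "(*)"] prod.cong) auto
  show "(\<Prod>j<n. sine M (f j) ((x(Suc i := x (Suc i) + 1)) (Suc j)))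
        + (\<Prod>j<n. sine M (f j) ((x(Suc i := x (Suc i) - 1)) (Suc j)))
      = 2 * cos (pi * real (f i) / real M) * (\<Prod>j<n. sine M (f j) (x (Suc j)))"
    unfolding * prod.remove[OF finite_lessThan i]
    by (simp add: distrib_right[symmetric] sine_neighbours)
qed

text \<open>Every Leibniz term is a product of sines with permuted frequencies, and the eigenvalue
  is symmetric in them. The equation holds on the whole lattice, not only in the alcove.\<close>

lemma sum_neighbours_sine_det:
  "(\<Sum>i<n. sine_det M n f (x(Suc i := x (Suc i) + 1)) + sine_det M n f (x(Suc i := x (Suc i) - 1)))
    = eigenvalue M n f * sine_det M n f x"
proof -
  have "(\<Sum>i<n. sine_det M n f (x(Suc i := x (Suc i) + 1)) + sine_det M n f (x(Suc i := x (Suc i) - 1)))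
    = (\<Sum>p | p permutes {..<n}. signof p * (\<Sum>i<n.
          (\<Prod>j<n. sine M ((f \<circ> p) j) ((x(Suc i := x (Suc i) + 1)) (Suc j)))
        + (\<Prod>j<n. sine M ((f \<circ> p) j) ((x(Suc i := x (Suc i) - 1)) (Suc j)))))"
    unfolding sine_det_leibniz sum.distrib[symmetric] sum_distrib_left 
    by (subst sum.swap) (simp add: distrib_left del: fun_upd_apply)
  also have "\<dots> = (\<Sum>p | p permutes {..<n}. signof p *
      (eigenvalue M n f * (\<Prod>j<n. sine M (f (p j)) (x (Suc j)))))"
    unfolding sum_neighbours_prod_sine by (intro sum.cong refl) (simp add: eigenvalue_permute)
  also have "\<dots> = eigenvalue M n f * sine_det M n f x"
    unfolding sine_det_leibniz sum_distrib_left by (intro sum.cong refl) (simp add: mult_ac)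
  finally show ?thesis .
qed

section \<open>Vanishing on the walls\<close>

lemma sine_det_eq_0_row:
  assumes "i < n" "x (Suc i) = 0 \<or> (M > 0 \<and> x (Suc i) = int M)"
  shows "sine_det M n f x = 0"
  unfolding sine_det_leibniz
proof (intro sum.neutral ballI)
  fix p
  \<comment> \<open>A row of zeros kills each Leibniz term. The value \<open>int M\<close> of a
    single coordinate is the outer wall for \<open>n = 1\<close>.\<close>
  have "\<exists>i\<in>{..<n}. sine M (f (p i)) (x (Suc i)) = 0"
    using assms by (intro bexI[of _ i]) auto
  then show "signof p * (\<Prod>i<n. sine M (f (p i)) (x (Suc i))) = 0"
    by (simp only: prod_zero[OF finite_lessThan] mult_zero_right)
qed

lemma sine_det_eq_0_equal:
  assumes "i < n" "j < n" "i \<noteq> j" "x (Suc i) = x (Suc j)"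
  shows "sine_det M n f x = 0"
  unfolding sine_det_def by (rule det_eq_0_if_rows_eq[of i _ j]) (use assms in auto)

text \<open>The common parity of the frequencies makes rows \<open>i\<close> and \<open>j\<close>
  equal up to one sign.\<close>

lemma sine_det_eq_0_reflected:
  assumes "i < n" "j < n" "i \<noteq> j" "x (Suc i) + x (Suc j) = int M"
    and "M > 0" "f \<in> {..<n} \<rightarrow> freqs M e"
  shows "sine_det M n f x = 0"
proof -
  define s :: real where "s = (if e then - 1 else 1)"
  define c where "c k = (if k = i then s else 1)" for k
  have "x (Suc i) = int M - x (Suc j)" using assms by simp
  moreover have "even (f k) = e" if "k < n" for k
    using that assms(6) by (auto simp: freqs_def)
  ultimately have *: "s * sine M (f k) (x (Suc i)) = sine M (f k) (x (Suc j))" if "k < n" for k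
    using that by (simp add: sine_diff_arg assms(5) s_def)
  have "det (mat n n (\<lambda>(k, l). c k * sine M (f l) (x (Suc k)))) = 0"
    by (rule det_eq_0_if_rows_eq[of i _ j]) (use assms * in \<open>auto simp: c_def\<close>)
  moreover have "(\<Prod>k<n. c k) \<noteq> 0" by (simp add: c_def s_def)
  ultimately show ?thesis unfolding det_scale_rows sine_det_def by simp
qed

lemma sine_det_eq_0_index:
  assumes "i < n" "j < n" "i \<noteq> j" "f i = f j"
  shows "sine_det M n f x = 0"
  unfolding sine_det_def
  by (rule det_identical_columns[of _ n i j]) (use assms in \<open>auto intro!: eq_vecI\<close>)

text \<open>A variant of the Cauchy-Binet formula: summing over all tuples, in any order, lets the
  sum distribute over the coordinates.\<close>

lemma sum_sine_det_prod_sine: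
  "(\<Sum>f\<in>{..<n} \<rightarrow>\<^sub>E A. sine_det M n f x * (\<Prod>i<n. sine M (f i) (y (Suc i))))
    = (\<Sum>p | p permutes {..<n}. signof p * (\<Prod>i<n. \<Sum>r\<in>A. sine M r (x (Suc i)) * sine M r (y (Suc (p i)))))"
  if "finite A"
proof -
  have "(\<Sum>f\<in>{..<n} \<rightarrow>\<^sub>E A. sine_det M n f x * (\<Prod>i<n. sine M (f i) (y (Suc i))))
    = (\<Sum>p | p permutes {..<n}. signof p * (\<Sum>f\<in>{..<n} \<rightarrow>\<^sub>E A.
        (\<Prod>i<n. sine M (f (p i)) (x (Suc i))) * (\<Prod>i<n. sine M (f i) (y (Suc i)))))"
    unfolding sine_det_leibniz sum_distrib_right sum_distrib_left
    by (subst sum.swap) (simp add: mult_ac)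
  also have "\<dots> = (\<Sum>p | p permutes {..<n}. signof p * 
      (\<Prod>i<n. \<Sum>r\<in>A. sine M r (x (Suc i)) * sine M r (y (Suc (p i)))))"
  proof (intro sum.cong refl arg_cong2[where f = "(*)"])
    fix p assume "p \<in> {p. p permutes {..<n}}"
    then have p: "p permutes {..<n}" by simp
    \<comment> \<open>Reindexing by the inverse permutation brings both factors to the same
      frequency \<open>f i\<close>, so the sum of products factors.\<close>
    define q where "q = Hilbert_Choice.inv p"
    have qp: "q (p i) = i" for i using p by (simp add: q_def permutes_inverses)
    have "(\<Prod>i<n. sine M (f (p i)) (x (Suc i))) = (\<Prod>i<n. sine M (f i) (x (Suc (q i))))" for f
      using prod.permute[OF p, of "\<lambda>i. sine M (f i) (x (Suc (q i)))"] by (simp add: comp_def qp)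
    then have "(\<Sum>f\<in>{..<n} \<rightarrow>\<^sub>E A. (\<Prod>i<n. sine M (f (p i)) (x (Suc i))) * (\<Prod>i<n. sine M (f i) (y (Suc i))))
      = (\<Sum>f\<in>{..<n} \<rightarrow>\<^sub>E A. \<Prod>i<n. sine M (f i) (x (Suc (q i))) * sine M (f i) (y (Suc i)))"
      by (simp add: prod.distrib)
    also have "\<dots> = (\<Prod>i<n. \<Sum>r\<in>A. sine M r (x (Suc (q i))) * sine M r (y (Suc i)))"
      using that by (subst prod_sum_PiE) auto
    also have "\<dots> = (\<Prod>i<n. \<Sum>r\<in>A. sine M r (x (Suc i)) * sine M r (y (Suc (p i))))"
      using prod.permute[OF p, of "\<lambda>i. \<Sum>r\<in>A. sine M r (x (Suc (q i))) * sine M r (y (Suc i))"]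
      by (simp add: comp_def qp)
    finally show "(\<Sum>f\<in>{..<n} \<rightarrow>\<^sub>E A. (\<Prod>i<n. sine M (f (p i)) (x (Suc i))) * (\<Prod>i<n. sine M (f i) (y (Suc i))))
      = (\<Prod>i<n. \<Sum>r\<in>A. sine M r (x (Suc i)) * sine M r (y (Suc (p i))))" .
  qed
  finally show ?thesis .
qed

section \<open>Exact number of walks\<close>

definition int_alcove :: "nat \<Rightarrow> nat \<Rightarrow> (nat \<Rightarrow> int) set" where
  "int_alcove n M = {x. (\<forall>i. i \<notin> {1..n} \<longrightarrow> x i = 0) \<and> (\<forall>i\<in>{1..<n}. x i > x (i + 1))
     \<and> x n > 0 \<and> x 1 + x 2 < int M}"

lemma real_vec_in_alcove_B_iff:
  assumes "2 * m = real M"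
  shows "real_vec x \<in> alcove_B n m \<longleftrightarrow> x \<in> int_alcove n M"
proof -
  have "(real_of_int (x 1) + of_int (x 2) < real M) = (x 1 + x 2 < int M)"
    by (metis of_int_add of_int_less_iff of_int_of_nat_eq)
  then show ?thesis using assms
    by (simp add: alcove_B_def int_alcove_def real_space_def real_vec_def)
qed

lemma int_alcove_decreasing:
  assumes "x \<in> int_alcove n M" "i < j" "j < n"
  shows "x (Suc j) < x (Suc i)"
  using assms(2,3)
proof (induction j)
  case (Suc j)
  have "x (Suc (Suc j)) < x (Suc j)"
    using assms(1) Suc.prems by (auto simp: int_alcove_def)
  then show ?case using Suc by (cases "i = j") auto
qed simp

lemma int_alcove_pos:
  assumes "x \<in> int_alcove n M" "i < n"
  shows "0 < x (Suc i)"
proof -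
  have "x (Suc (n - 1)) \<le> x (Suc i)"
  proof (cases "i = n - 1")
    case False
    then have "i < n - 1" "n - 1 < n" using assms(2) by linarith+
    then show ?thesis using int_alcove_decreasing[OF assms(1)] less_imp_le by blast
  qed simp
  then show ?thesis using assms by (simp add: int_alcove_def)
qed

lemma int_alcove_add_less:
  assumes "x \<in> int_alcove n M" "i < j" "j < n"
  shows "x (Suc i) + x (Suc j) < int M"
proof -
  have "x (Suc i) \<le> x (Suc 0)"
    using int_alcove_decreasing[OF assms(1), of 0 i] assms by (cases "i = 0") auto
  moreover have "x (Suc j) \<le> x (Suc 1)"
    using int_alcove_decreasing[OF assms(1), of 1 j] assms by (cases "j = 1") auto
  ultimately show ?thesis using assms by (simp add: int_alcove_def numeral_2_eq_2)
qed

lemma int_alcove_add_less':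
  assumes "x \<in> int_alcove n M" "i \<noteq> j" "i < n" "j < n"
  shows "x (Suc i) + x (Suc j) < int M"
  using int_alcove_add_less[OF assms(1), of i j] int_alcove_add_less[OF assms(1), of j i] assms
  by (cases "i < j") (auto simp: add.commute)

lemma int_alcove_less:
  assumes "x \<in> int_alcove n M" "i < n"
  shows "x (Suc i) < int M"
proof (cases "n = 1")
  case True
  then have "x (Suc (Suc 0)) = 0" using assms(1) by (auto simp: int_alcove_def)
  then show ?thesis using assms True by (auto simp: int_alcove_def numeral_2_eq_2)
next
  case False
  define j where "j = (if i = 0 then 1 else 0 :: nat)"
  have "j < n" "i \<noteq> j" using False assms by (auto simp: j_def)
  then show ?thesis
    using int_alcove_add_less'[OF assms(1), of i j] int_alcove_pos[OF assms(1), of j] assms by auto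
qed

text \<open>The wall inequalities are strict between integers and a unit step shifts each by at most
  one, so leaving the alcove means landing exactly on a wall.\<close>

lemma sine_det_eq_0_outside:
  assumes x: "x \<in> int_alcove n M" and "i < n" and s: "s = 1 \<or> s = - 1"
    and x': "x' = x(Suc i := x (Suc i) + s)" "x' \<notin> int_alcove n M"
    and f: "f \<in> {..<n} \<rightarrow> freqs M e"
  shows "sine_det M n f x' = 0"
proof -
  have M: "M > 0" using int_alcove_pos[OF x \<open>i < n\<close>] int_alcove_less[OF x \<open>i < n\<close>] by simp
  have x'_supp: "x' j = 0" if "j \<notin> {1..n}" for j
    using x x' that \<open>i < n\<close> by (auto simp: int_alcove_def)
  have "\<not> ((\<forall>j\<in>{1..<n}. x' j > x' (j + 1)) \<and> x' n > 0 \<and> x' 1 + x' 2 < int M)"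
    using x'(2) x'_supp unfolding int_alcove_def by blast
  then consider j where "j \<in> {1..<n}" "x' j \<le> x' (j + 1)" | "x' n \<le> 0" | "x' 1 + x' 2 \<ge> int M"
    unfolding de_Morgan_conj ball_simps not_less by blast
  then show ?thesis
  proof cases
    case (1 j)
    then obtain l where l: "j = Suc l" "Suc l < n" by (cases j) auto
    have "x (Suc (Suc l)) < x (Suc l)" using x l by (auto simp: int_alcove_def)
    then have "x' (Suc l) = x' (Suc (Suc l))"
      using 1 s by (auto simp: l x'(1) split: if_splits)
    then show ?thesis using sine_det_eq_0_equal[of l n "Suc l" x'] l by simp
  next
    case 2
    have "x n > 0" using x by (simp add: int_alcove_def)
    then have "x' n = 0" using 2 s by (auto simp: x'(1) split: if_splits)
    then show ?thesis using sine_det_eq_0_row[of "n - 1" n x'] \<open>i < n\<close> by simp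
  next
    case 3
    have "x 1 + x 2 < int M" using x by (simp add: int_alcove_def)
    then have *: "x' 1 + x' 2 = int M" using 3 s by (auto simp: x'(1) numeral_2_eq_2 split: if_splits)
    show ?thesis
    \<comment> \<open>For \<open>n = 1\<close> the coordinate \<open>x' 2\<close> is the default
      \<open>0\<close>, so this wall reads \<open>x' 1 = int M\<close>; otherwise it is a reflection
      wall.\<close>
    proof (cases "n = 1")
      case True
      then have "x' (Suc 0) = int M" using * x'_supp[of 2] by simp
      then show ?thesis using sine_det_eq_0_row[of 0 n x' M] True M by simp
    next
      case False
      then show ?thesis
        using sine_det_eq_0_reflected[of 0 n 1 x' M f e] * f M \<open>i < n\<close> by (simp add: numeral_2_eq_2)
    qed
  qed
qed

section \<open>Decomposing walks by their first step\<close>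

lemma walks_outside: "\<eta> \<notin> R \<Longrightarrow> walks n R \<eta> \<mu> k = {}"
  by (auto simp: walks_def)

lemma walks_0: "walks n R \<eta> \<mu> 0 = (if \<eta> = \<mu> \<and> \<eta> \<in> R then {[\<eta>]} else {})"
  by (auto simp: walks_def length_Suc_conv)

lemma walks_Suc:
  assumes "\<eta> \<in> R"
  shows "walks n R \<eta> \<mu> (Suc k) = (\<Union>\<eta>'\<in>{\<eta>'. \<eta>' - \<eta> \<in> standard_steps n}. (#) \<eta> ` walks n R \<eta>' \<mu> k)"
    (is "?L = ?R")
proof (intro equalityI subsetI)
  fix p assume p: "p \<in> ?L"
  then obtain q where q: "p = \<eta> # q" by (cases p) (auto simp: walks_def)
  have step: "p ! Suc i - p ! i \<in> standard_steps n" if "i \<le> k" for i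
  proof -
    have "Suc i \<in> {1..Suc k}" using that by simp
    then have "p ! Suc i - p ! (Suc i - 1) \<in> standard_steps n"
      using p unfolding walks_def by blast
    then show ?thesis by simp
  qed
  have "q ! i - q ! (i - 1) \<in> standard_steps n" if "i \<in> {1..k}" for i
    using step[of i] that q by (cases i) auto
  moreover have "q ! i \<in> R" if "i \<le> k" for i
  proof -
    have "p ! Suc i \<in> R" using p that unfolding walks_def by blast
    then show ?thesis by (simp add: q)
  qed
  moreover have "length q = k + 1" "q ! k = \<mu>" using p by (simp_all add: walks_def q)
  ultimately have "q \<in> walks n R (q ! 0) \<mu> k" unfolding walks_def by blast
  moreover have "q ! 0 - \<eta> \<in> standard_steps n" using step[of 0] by (simp add: q)
  ultimately show "p \<in> ?R" using q by auto
next
  fix p assume "p \<in> ?R"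
  then obtain q \<eta>' where q: "p = \<eta> # q" "\<eta>' - \<eta> \<in> standard_steps n" "q \<in> walks n R \<eta>' \<mu> k"
    by auto
  have "p ! i - p ! (i - 1) \<in> standard_steps n" if "i \<in> {1..Suc k}" for i
  proof (cases "i = 1")
    case True
    then show ?thesis using q by (simp add: walks_def)
  next
    case False
    then obtain j where j: "i = Suc (Suc j)" "Suc j \<in> {1..k}" 
      using \<open>i \<in> {1..Suc k}\<close> by (cases i; cases "i - 1") auto
    then have "q ! Suc j - q ! (Suc j - 1) \<in> standard_steps n"
      using q(3) unfolding walks_def by blast
    then show ?thesis by (simp add: q(1) j)
  qed
  moreover have "p ! i \<in> R" if "i \<le> Suc k" for i
    using that assms q(3) by (cases i) (auto simp: q(1) walks_def)
  moreover have "length p = Suc k + 1" "p ! 0 = \<eta>" "p ! Suc k = \<mu>" using q by (auto simp: walks_def)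
  ultimately show "p \<in> ?L" unfolding walks_def by blast
qed

definition int_neighbour :: "(nat \<Rightarrow> int) \<Rightarrow> nat \<times> int \<Rightarrow> nat \<Rightarrow> int" where
  "int_neighbour x = (\<lambda>(i, s). x(Suc i := x (Suc i) + s))"

text \<open>Only integer points are reachable from an integer point, so the recursion for walks in
  real space can be run on integer vectors, with steps indexed by coordinate and sign.\<close>

lemma real_vec_neighbours:
  "{y. y - real_vec x \<in> standard_steps n} = (\<lambda>u. real_vec (int_neighbour x u)) ` ({..<n} \<times> {1, - 1})"
    (is "?L = ?R")
proof (intro equalityI subsetI)
  fix y assume "y \<in> ?L"
  then obtain i where i: "i \<in> {1..n}"
    "y - real_vec x = Defs.unit_vec i \<or> y - real_vec x = - Defs.unit_vec i" 
    by (auto simp: standard_steps_def)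
  obtain l where l: "i = Suc l" "l < n" using i(1) by (cases i) auto
  from i(2) show "y \<in> ?R"
  proof
    assume "y - real_vec x = Defs.unit_vec i"
    then have "y j = real_of_int (x j) + Defs.unit_vec i j" for j
      by (auto simp: fun_eq_iff fun_diff_def real_vec_def algebra_simps)
    then have "y = real_vec (int_neighbour x (l, 1))"
      by (auto simp: fun_eq_iff real_vec_def int_neighbour_def Defs.unit_vec_def l)
    then show ?thesis using l by blast
  next
    assume "y - real_vec x = - Defs.unit_vec i"
    then have "y j = real_of_int (x j) - Defs.unit_vec i j" for j
      by (auto simp: fun_eq_iff fun_diff_def fun_Compl_def real_vec_def algebra_simps)
    then have "y = real_vec (int_neighbour x (l, - 1))"
      by (auto simp: fun_eq_iff real_vec_def int_neighbour_def Defs.unit_vec_def l)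
    then show ?thesis using l by blast
  qed
next
  fix y assume "y \<in> ?R"
  then obtain l where l: "l < n" 
    "y = real_vec (int_neighbour x (l, 1)) \<or> y = real_vec (int_neighbour x (l, - 1))"
    by auto
  from l(2) have "y - real_vec x = Defs.unit_vec (Suc l) \<or> y - real_vec x = - Defs.unit_vec (Suc l)"
    by (rule disj_forward)
      (auto simp: fun_eq_iff fun_diff_def fun_Compl_def real_vec_def int_neighbour_def Defs.unit_vec_def)
  then show "y \<in> ?L" using l(1) by (auto simp: standard_steps_def intro!: bexI[of _ "Suc l"])
qed

lemma inj_on_real_vec_neighbour:
  "inj_on (\<lambda>u. real_vec (int_neighbour x u)) ({..<n} \<times> {1, - 1})"
proof (rule inj_onI)
  fix u v :: "nat \<times> int"
  assume uv: "u \<in> {..<n} \<times> {1, - 1}" "v \<in> {..<n} \<times> {1, - 1}"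
    and "real_vec (int_neighbour x u) = real_vec (int_neighbour x v)"
  then have *: "int_neighbour x u j = int_neighbour x v j" for j
    by (simp add: real_vec_def fun_eq_iff)
  obtain i s j t where "u = (i, s)" "v = (j, t)" by (cases u; cases v)
  then show "u = v" using *[of "Suc i"] uv by (auto simp: int_neighbour_def split: if_splits)
qed

lemma finite_walks_real_vec: "finite (walks n R (real_vec x) \<mu> k)"
proof (induction k arbitrary: x)
  case 0
  then show ?case by (simp add: walks_0)
next
  case (Suc k)
  then show ?case
    by (cases "real_vec x \<in> R") (auto simp: walks_Suc real_vec_neighbours walks_outside)
qed

lemma card_walks_Suc:
  assumes "real_vec x \<in> R"
  shows "card (walks n R (real_vec x) \<mu> (Suc k)) = (\<Sum>i<n.
      card (walks n R (real_vec (x(Suc i := x (Suc i) + 1))) \<mu> k)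
    + card (walks n R (real_vec (x(Suc i := x (Suc i) - 1))) \<mu> k))"
proof -
  have "card (walks n R (real_vec x) \<mu> (Suc k)) =
    (\<Sum>y\<in>(\<lambda>u. real_vec (int_neighbour x u)) ` ({..<n} \<times> {1, - 1}).
      card ((#) (real_vec x) ` walks n R y \<mu> k))"
    unfolding walks_Suc[OF assms] real_vec_neighbours
  \<comment> \<open>The pieces are disjoint because the tail of a walk begins at its second point,
    which differs between them.\<close>
  proof (rule card_UN_disjoint)
    show "\<forall>y\<in>(\<lambda>u. real_vec (int_neighbour x u)) ` ({..<n} \<times> {1, - 1}).
        finite ((#) (real_vec x) ` walks n R y \<mu> k)"
      by (auto intro!: finite_imageI finite_walks_real_vec)
  qed (auto simp: walks_def)
  also have "\<dots> = (\<Sum>u\<in>{..<n} \<times> {1, - 1}. card (walks n R (real_vec (int_neighbour x u)) \<mu> k))"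
    by (subst sum.reindex[OF inj_on_real_vec_neighbour]) (simp add: card_image)
  also have "\<dots> = (\<Sum>i<n. \<Sum>s\<in>{1, - 1}. card (walks n R (real_vec (int_neighbour x (i, s))) \<mu> k))"
    unfolding sum.cartesian_product by (rule sum.cong) auto
  finally show ?thesis by (simp add: int_neighbour_def)
qed

text \<open>An expansion in eigenfunctions. The vector \<open>y\<close> enters through a plain
  product because summing over all orders of a tuple rebuilds its determinant; a tuple with a
  repeated frequency contributes nothing.\<close>

definition spectral_sum :: "nat \<Rightarrow> nat \<Rightarrow> nat \<Rightarrow> (nat \<Rightarrow> int) \<Rightarrow> (nat \<Rightarrow> int) \<Rightarrow> real" where
  "spectral_sum M n k x y = (\<Sum>e\<in>UNIV. \<Sum>f\<in>{..<n} \<rightarrow>\<^sub>E freqs M e.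
     eigenvalue M n f ^ k * (sine_det M n f x * (\<Prod>i<n. sine M (f i) (y (Suc i)))))"

text \<open>The extra factor \<open>eigenvalue M n f\<close> is the step operator acting on
  \<open>x\<close>. This is the recursion of the walk counts, here valid at every lattice
  point.\<close>

lemma spectral_sum_Suc:
  "spectral_sum M n (Suc k) x y
    = (\<Sum>i<n. spectral_sum M n k (x(Suc i := x (Suc i) + 1)) y + spectral_sum M n k (x(Suc i := x (Suc i) - 1)) y)"
proof -
  have "(\<Sum>i<n. spectral_sum M n k (x(Suc i := x (Suc i) + 1)) y + spectral_sum M n k (x(Suc i := x (Suc i) - 1)) y)
    = (\<Sum>e\<in>UNIV. \<Sum>f\<in>{..<n} \<rightarrow>\<^sub>E freqs M e. eigenvalue M n f ^ k * (\<Prod>i<n. sine M (f i) (y (Suc i)))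
       * (\<Sum>i<n. sine_det M n f (x(Suc i := x (Suc i) + 1)) + sine_det M n f (x(Suc i := x (Suc i) - 1))))"
    unfolding spectral_sum_def sum.distrib[symmetric] sum_distrib_left
    by (subst sum.swap, intro sum.cong refl, subst sum.swap) (simp add: algebra_simps)
  also have "\<dots> = spectral_sum M n (Suc k) x y"
    unfolding sum_neighbours_sine_det spectral_sum_def by (simp add: mult_ac)
  finally show ?thesis ..
qed

section \<open>The initial value of the spectral sum\<close>

lemma decreasing_permutation_id:
  fixes x y :: "nat \<Rightarrow> 'a :: linorder"
  assumes "\<And>i j. i < j \<Longrightarrow> j < n \<Longrightarrow> x j < x i" "\<And>i j. i < j \<Longrightarrow> j < n \<Longrightarrow> y j < y i"
    and p: "p permutes {..<n}" and xy: "\<And>i. i < n \<Longrightarrow> x i = y (p i)"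
  shows "p = id"
proof -
  have less: "p i < p j" if "i < j" "j < n" for i j
  proof (rule ccontr)
    have "p i < n" "p j < n" "p i \<noteq> p j"
      using permutes_in_image[OF p] permutes_inj[OF p] that by (auto dest: injD)
    moreover assume "\<not> p i < p j"
    ultimately have "y (p i) < y (p j)" using assms(2)[of "p j" "p i"] by simp
    then show False using assms(1)[OF that] xy[of i] xy[of j] that by simp
  qed
  have ge: "i \<le> p i" if "i < n" for i using that
  proof (induction i)
    case (Suc i)
    then show ?case using less[of i "Suc i"] by simp
  qed simp
  \<comment> \<open>A permutation preserves the total sum, so none of the inequalities
    \<open>i \<le> p i\<close> can be strict.\<close>
  have "p i = i" if "i < n" for i
  proof -
    have "(\<Sum>i<n. p i) = (\<Sum>i<n. i)"
      using sum.permute[OF p, of id] by simp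
    then show ?thesis
      using sum_mono_inv[of "\<lambda>i. i" "{..<n}" p i] ge that by simp
  qed
  then show ?thesis using p by (auto simp: fun_eq_iff permutes_def)
qed

text \<open>
  Each term of the Leibniz expansion contains at most one reflected entry
  \<open>x (Suc i) + y (Suc (p i)) = M\<close>, so these entries cancel between the two parities of frequencies.
\<close>
lemma spectral_sum_0:
  assumes x: "x \<in> int_alcove n M" and y: "y \<in> int_alcove n M"
  shows "spectral_sum M n 0 x y = 2 * (real M / 4) ^ n * (if x = y then 1 else 0)"
proof -
  define D where "D p i = (if x (Suc i) = y (Suc (p i)) then 1 else 0 :: real)" for p i
  define E where "E p i = (if x (Suc i) + y (Suc (p i)) = int M then 1 else 0 :: real)" for p i
  define P where "P = {p. p permutes {..<n}}"
  have finP: "finite P" by (simp add: P_def finite_permutations)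
  have p_less: "p i < n" if "p \<in> P" "i < n" for p i
    using that permutes_in_image[of p "{..<n}" i] by (simp add: P_def)
  have "spectral_sum M n 0 x y = (\<Sum>e\<in>UNIV. \<Sum>p\<in>P.
      signof p * (\<Prod>i<n. real M / 4 * (D p i + (if e then - 1 else 1) * E p i)))"
    unfolding spectral_sum_def power_0 mult_1 sum_sine_det_prod_sine[OF finite_freqs] P_def[symmetric]
    by (intro sum.cong refl arg_cong2[where f = "(*)"] prod.cong)
       (simp only: D_def E_def sum_sine_freqs int_alcove_pos[OF x] int_alcove_less[OF x]
         int_alcove_pos[OF y] int_alcove_less[OF y] p_less lessThan_iff)
  also have "\<dots> = (real M / 4) ^ n * (\<Sum>p\<in>P. signof p * ((\<Prod>i<n. D p i - E p i) + (\<Prod>i<n. D p i + E p i)))"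
    unfolding prod.distrib by (simp add: UNIV_bool sum_distrib_left sum.distrib algebra_simps)
  also have "(\<Sum>p\<in>P. signof p * ((\<Prod>i<n. D p i - E p i) + (\<Prod>i<n. D p i + E p i)))
    = (\<Sum>p\<in>P. signof p * (2 * (\<Prod>i<n. D p i)))"
  proof (intro sum.cong refl arg_cong2[where f = "(*)"])
    fix p assume p: "p \<in> P"
    show "(\<Prod>i<n. D p i - E p i) + (\<Prod>i<n. D p i + E p i) = 2 * (\<Prod>i<n. D p i)"
    proof (cases "\<exists>i<n. x (Suc i) + y (Suc (p i)) = int M")
      case True
      then obtain i where i: "i < n" "x (Suc i) + y (Suc (p i)) = int M" by auto
      \<comment> \<open>Two reflected entries would make four coordinates add up to
        \<open>2 * int M\<close>, but two coordinates of one alcove point sum to less than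
        \<open>int M\<close>.\<close>
      have "E p j = 0" if "j < n" "j \<noteq> i" for j
      proof -
        have "p i \<noteq> p j" using p that by (auto simp: P_def dest: permutes_inj injD)
        then have "y (Suc (p i)) + y (Suc (p j)) < int M"
          using int_alcove_add_less'[OF y] p_less[OF p] i that by simp
        moreover have "x (Suc i) + x (Suc j) < int M"
          using int_alcove_add_less'[OF x, of i j] i that by simp
        ultimately show ?thesis using i by (simp add: E_def)
      qed
      \<comment> \<open>The two products differ only in the sign of the single reflected factor, so
        it drops out of their sum.\<close>
      then show ?thesis
        using i by (simp add: prod.remove[of "{..<n}" i] flip: distrib_right)
    next
      case False
      then show ?thesis by (simp add: E_def)
    qed
  qed
  also have "\<dots> = 2 * (\<Sum>p\<in>P. signof p * (\<Prod>i<n. D p i))"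
    by (simp add: sum_distrib_left mult_ac)
  also have "(\<Sum>p\<in>P. signof p * (\<Prod>i<n. D p i)) = (\<Sum>p\<in>P. if p = id \<and> x = y then 1 else 0)"
  proof (intro sum.cong refl)
    fix p assume p: "p \<in> P"
    show "signof p * (\<Prod>i<n. D p i) = (if p = id \<and> x = y then 1 else 0)"
    proof (cases "\<forall>i<n. x (Suc i) = y (Suc (p i))")
      case True
      have "p = id"
        by (rule decreasing_permutation_id[of n "\<lambda>i. x (Suc i)" "\<lambda>i. y (Suc i)"])
           (use int_alcove_decreasing[OF x] int_alcove_decreasing[OF y] p True in \<open>auto simp: P_def\<close>)
      have "x j = y j" for j
      proof (cases "j \<in> {1..n}")
        case True
        then show ?thesis using \<open>\<forall>i<n. x (Suc i) = y (Suc (p i))\<close> \<open>p = id\<close> by (cases j) auto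
      next
        case False
        then show ?thesis using x y by (auto simp: int_alcove_def)
      qed
      then have "x = y" by auto
      then show ?thesis using True \<open>p = id\<close> by (simp add: D_def)
    next
      case False
      then have "(\<Prod>i<n. D p i) = 0" by (auto simp: D_def)
      moreover have "\<not> (p = id \<and> x = y)" using False by auto
      ultimately show ?thesis by (simp only: mult_zero_right if_False)
    qed
  qed
  also have "\<dots> = (if x = y then 1 else 0)"
    using finP permutes_id[of "{..<n}"] by (simp add: P_def)
  finally show ?thesis by (simp add: mult_ac)
qed

text \<open>Both sides obey the same recursion, and off the alcove both vanish at every neighbour
  that a step can reach. The constant normalises the initial value
  \<open>2 * (real M / 4) ^ n\<close>.\<close>

theorem card_walks_alcove_B:
  assumes m: "2 * m = real M" and "n \<ge> 1"
    and x: "x \<in> int_alcove n M" and y: "y \<in> int_alcove n M"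
  shows "real (card (walks n (alcove_B n m) (real_vec x) (real_vec y) k))
    = (4 / real M) ^ n / 2 * spectral_sum M n k x y"
  using x
proof (induction k arbitrary: x)
  case 0
  have "M > 0" using int_alcove_pos[OF y, of 0] int_alcove_less[OF y, of 0] \<open>n \<ge> 1\<close> by simp
  moreover have "real_vec x = real_vec y \<longleftrightarrow> x = y" by (simp add: real_vec_def fun_eq_iff)
  moreover have "real_vec x \<in> alcove_B n m" using 0 real_vec_in_alcove_B_iff[OF m] by simp
  ultimately show ?case by (simp add: walks_0 spectral_sum_0[OF 0 y] power_divide)
next
  case (Suc k)
  let ?N = "\<lambda>x. real (card (walks n (alcove_B n m) (real_vec x) (real_vec y) k))"
  have *: "?N x' = (4 / real M) ^ n / 2 * spectral_sum M n k x' y"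
    if "i < n" "x' = x(Suc i := x (Suc i) + s)" "s = 1 \<or> s = - 1" for i x' s
  proof (cases "x' \<in> int_alcove n M")
    case False
    then have "sine_det M n f x' = 0" if "f \<in> {..<n} \<rightarrow>\<^sub>E freqs M e" for f e
      using sine_det_eq_0_outside[OF Suc.prems \<open>i < n\<close> \<open>s = 1 \<or> s = - 1\<close> \<open>x' = _\<close>] that by auto
    then have "spectral_sum M n k x' y = 0" by (simp add: spectral_sum_def)
    then show ?thesis using False by (simp add: walks_outside real_vec_in_alcove_B_iff[OF m])
  qed (rule Suc.IH)
  have "real_vec x \<in> alcove_B n m" using Suc.prems real_vec_in_alcove_B_iff[OF m] by simp
  then have "real (card (walks n (alcove_B n m) (real_vec x) (real_vec y) (Suc k)))
    = (\<Sum>i<n. ?N (x(Suc i := x (Suc i) + 1)) + ?N (x(Suc i := x (Suc i) - 1)))"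
    by (simp add: card_walks_Suc)
  also have "\<dots> = (\<Sum>i<n. (4 / real M) ^ n / 2 * (spectral_sum M n k (x(Suc i := x (Suc i) + 1)) y
      + spectral_sum M n k (x(Suc i := x (Suc i) - 1)) y))"
  proof (intro sum.cong refl)
    fix i assume "i \<in> {..<n}"
    then show "?N (x(Suc i := x (Suc i) + 1)) + ?N (x(Suc i := x (Suc i) - 1))
      = (4 / real M) ^ n / 2 * (spectral_sum M n k (x(Suc i := x (Suc i) + 1)) y
      + spectral_sum M n k (x(Suc i := x (Suc i) - 1)) y)"
      using *[of i "x(Suc i := x (Suc i) + 1)" 1] *[of i "x(Suc i := x (Suc i) - 1)" "- 1"]
      by (simp add: distrib_left)
  qed
  also have "\<dots> = (4 / real M) ^ n / 2 * spectral_sum M n (Suc k) x y"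
    unfolding spectral_sum_Suc sum_distrib_left ..
  finally show ?case .
qed

section \<open>The dominant eigenvalues\<close>

text \<open>Induction by removing the largest frequency. Equal parity spaces the elements by at
  least two, so the largest of \<open>Suc n\<close> elements is at least \<open>2 * n + 1\<close>,
  and the cosine decreases on \<open>[0, pi]\<close>.\<close>

lemma sum_cos_freqs_le:
  assumes "A \<subseteq> freqs M e" "card A = n"
  shows "(\<Sum>a\<in>A. cos (pi * real a / real M)) \<le> (\<Sum>i<n. cos (pi * real (2 * i + 1) / real M))
    \<and> ((\<Sum>a\<in>A. cos (pi * real a / real M)) = (\<Sum>i<n. cos (pi * real (2 * i + 1) / real M))
        \<longrightarrow> A = (\<lambda>i. 2 * i + 1) ` {..<n})"
  using assms
proof (induction n arbitrary: A)
  case 0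
  then show ?case using finite_subset[OF _ finite_freqs] by fastforce
next
  case (Suc n)
  have fin: "finite A" using Suc.prems finite_subset[OF _ finite_freqs] by blast
  have "A \<noteq> {}" using Suc.prems by auto
  define a where "a = Max A"
  have a: "a \<in> A" "\<And>b. b \<in> A \<Longrightarrow> b \<le> a" using fin \<open>A \<noteq> {}\<close> by (auto simp: a_def)
  have parity: "0 < b" "b < M" "even b = e" if "b \<in> A" for b
    using Suc.prems that by (auto simp: freqs_def)
  \<comment> \<open>For numbers of one parity this map is injective; counting its values bounds
    \<open>card A\<close> in terms of the maximum, for odd and even frequencies alike.\<close>
  have "inj_on (\<lambda>b. (b - 1) div 2) A"
  proof (rule inj_onI)
    fix b c assume "b \<in> A" "c \<in> A" "(b - 1) div 2 = (c - 1) div 2"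
    moreover have "0 < b" "0 < c" "even b = even c" using parity[OF \<open>b \<in> A\<close>] parity[OF \<open>c \<in> A\<close>] by simp_all
    ultimately show "b = c" by presburger
  qed
  moreover have "(\<lambda>b. (b - 1) div 2) ` A \<subseteq> {..(a - 1) div 2}"
    using a by (auto intro!: div_le_mono diff_le_mono)
  ultimately have "card A \<le> card {..(a - 1) div 2}" by (intro card_inj_on_le) auto
  then have a_ge: "2 * n + 1 \<le> a" using Suc.prems parity[OF a(1)] by simp
  define h where "h b = cos (pi * real b / real M)" for b
  have h_le: "h a \<le> h (2 * n + 1)" 
    unfolding h_def using a_ge parity[OF a(1)]
    by (intro cos_monotone_0_pi_le) (auto simp: field_simps simp del: of_nat_add of_nat_mult of_nat_Suc)
  have h_less: "h a < h (2 * n + 1)" if "a \<noteq> 2 * n + 1"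
    unfolding h_def using a_ge parity[OF a(1)] that
    by (intro cos_monotone_0_pi) (auto simp: field_simps simp del: of_nat_add of_nat_mult of_nat_Suc)
  have sumA: "(\<Sum>a\<in>A. h a) = h a + (\<Sum>b\<in>A - {a}. h b)"
    using a fin by (simp add: sum.remove)
  have IH: "(\<Sum>b\<in>A - {a}. h b) \<le> (\<Sum>i<n. h (2 * i + 1))
      \<and> ((\<Sum>b\<in>A - {a}. h b) = (\<Sum>i<n. h (2 * i + 1)) \<longrightarrow> A - {a} = (\<lambda>i. 2 * i + 1) ` {..<n})"
    unfolding h_def by (rule Suc.IH) (use Suc.prems a fin in auto)
  have "A = (\<lambda>i. 2 * i + 1) ` {..<Suc n}" if "(\<Sum>a\<in>A. h a) = (\<Sum>i<Suc n. h (2 * i + 1))"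
  proof -
    have *: "h a + (\<Sum>b\<in>A - {a}. h b) = (\<Sum>i<n. h (2 * i + 1)) + h (2 * n + 1)"
      using that sumA by simp
    \<comment> \<open>Equality of the totals forces equality in both partial bounds.\<close>
    have "(\<Sum>b\<in>A - {a}. h b) = (\<Sum>i<n. h (2 * i + 1))" using * IH h_le by linarith
    then have "A - {a} = (\<lambda>i. 2 * i + 1) ` {..<n}" using IH by blast
    moreover have "a = 2 * n + 1" using * IH h_less by force
    ultimately show ?thesis using a by (auto simp: lessThan_Suc)
  qed
  moreover have "(\<Sum>a\<in>A. h a) \<le> (\<Sum>i<Suc n. h (2 * i + 1))"
    using sumA IH h_le by simp
  ultimately show ?case unfolding h_def by blast
qed

section \<open>Tuples of frequencies and their amplitudes\<close>

definition tuples :: "nat \<Rightarrow> nat \<Rightarrow> (nat \<Rightarrow> nat) set" where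
  "tuples M n = (\<Union>e. {..<n} \<rightarrow>\<^sub>E freqs M e)"

lemma finite_tuples [simp]: "finite (tuples M n)"
  by (simp add: tuples_def finite_PiE)

definition amplitude :: "nat \<Rightarrow> nat \<Rightarrow> (nat \<Rightarrow> int) \<Rightarrow> (nat \<Rightarrow> int) \<Rightarrow> (nat \<Rightarrow> nat) \<Rightarrow> real" where
  "amplitude M n x y f = sine_det M n f x * (\<Prod>i<n. sine M (f i) (y (Suc i)))"

text \<open>The parity class of a tuple can be read off \<open>f 0\<close>, which exists because
  \<open>n \<ge> 1\<close>; so the two classes are disjoint.\<close>

lemma sum_tuples:
  fixes t :: "(nat \<Rightarrow> nat) \<Rightarrow> real"
  assumes "n \<ge> 1"
  shows "(\<Sum>f\<in>tuples M n. t f) = (\<Sum>e\<in>UNIV. \<Sum>f\<in>{..<n} \<rightarrow>\<^sub>E freqs M e. t f)"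
  unfolding tuples_def
proof (rule sum.UNION_disjoint)
  show "\<forall>e\<in>UNIV. \<forall>e'\<in>UNIV. e \<noteq> e' \<longrightarrow> ({..<n} \<rightarrow>\<^sub>E freqs M e) \<inter> ({..<n} \<rightarrow>\<^sub>E freqs M e') = {}"
  proof (intro ballI impI equals0I)
    fix e e' f assume "e \<noteq> e'" and f: "f \<in> ({..<n} \<rightarrow>\<^sub>E freqs M e) \<inter> ({..<n} \<rightarrow>\<^sub>E freqs M e')"
    have "f 0 \<in> freqs M e" by (rule PiE_mem[of f "{..<n}"]) (use f assms in simp_all)
    moreover have "f 0 \<in> freqs M e'" by (rule PiE_mem[of f "{..<n}"]) (use f assms in simp_all)
    ultimately show False using \<open>e \<noteq> e'\<close> by (simp add: freqs_def)
  qed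
  show "\<forall>e\<in>UNIV. finite ({..<n} \<rightarrow>\<^sub>E freqs M e)" by (simp add: finite_PiE)
qed simp

lemma spectral_sum_tuples:
  "n \<ge> 1 \<Longrightarrow> spectral_sum M n k x y = (\<Sum>f\<in>tuples M n. eigenvalue M n f ^ k * amplitude M n x y f)"
  unfolding spectral_sum_def amplitude_def by (simp only: sum_tuples)

section \<open>Tuples attaining the largest eigenvalue\<close>

definition ground :: "nat \<Rightarrow> nat \<Rightarrow> real" where
  "ground M n = eigenvalue M n (\<lambda>i. 2 * i + 1)"

text \<open>\<open>restrict\<close> yields the extensional functions of which \<open>tuples\<close>
  consists.\<close>

definition ground_tuple :: "nat \<Rightarrow> (nat \<Rightarrow> nat) \<Rightarrow> nat \<Rightarrow> nat" where
  "ground_tuple n p = restrict (\<lambda>i. 2 * p i + 1) {..<n}"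

definition ground_tuples :: "nat \<Rightarrow> (nat \<Rightarrow> nat) set" where
  "ground_tuples n = ground_tuple n ` {p. p permutes {..<n}}"

lemma inj_on_ground_tuple: "inj_on (ground_tuple n) {p. p permutes {..<n}}"
proof (rule inj_onI)
  fix p q assume pq: "p \<in> {p. p permutes {..<n}}" "q \<in> {p. p permutes {..<n}}" "ground_tuple n p = ground_tuple n q"
  have "p i = q i" for i
  proof (cases "i < n")
    case True
    then show ?thesis using fun_cong[OF pq(3), of i] by (simp add: ground_tuple_def)
  next
    case False
    then show ?thesis using pq by (simp add: permutes_def)
  qed
  then show "p = q" by auto
qed

lemma ground_tuple_eigenvalue:
  assumes "f \<in> ground_tuples n"
  shows "eigenvalue M n f = ground M n"
proof -
  from assms obtain p where p: "p permutes {..<n}" "f = ground_tuple n p"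
    by (auto simp: ground_tuples_def)
  have "eigenvalue M n f = eigenvalue M n ((\<lambda>i. 2 * i + 1) \<circ> p)"
    by (simp add: eigenvalue_def p ground_tuple_def)
  then show ?thesis using p by (simp only: eigenvalue_permute ground_def)
qed

lemma eigenvalue_le_ground:
  assumes "f \<in> tuples M n" "inj_on f {..<n}"
  shows "eigenvalue M n f \<le> ground M n"
    and "eigenvalue M n f = ground M n \<Longrightarrow> f \<in> ground_tuples n"
proof -
  obtain e where f: "f \<in> {..<n} \<rightarrow>\<^sub>E freqs M e" using assms by (auto simp: tuples_def)
  \<comment> \<open>An injective tuple enters its eigenvalue only through its image, so the bound
    for sets of frequencies applies.\<close>
  have L: "eigenvalue M n f = 2 * (\<Sum>a\<in>f ` {..<n}. cos (pi * real a / real M))"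
    by (simp add: sum.reindex[OF assms(2)] eigenvalue_def sum_distrib_left)
  have G: "ground M n = 2 * (\<Sum>i<n. cos (pi * real (2 * i + 1) / real M))"
    by (simp add: ground_def eigenvalue_def sum_distrib_left)
  have *: "f ` {..<n} \<subseteq> freqs M e" "card (f ` {..<n}) = n"
    using f by (auto simp: card_image assms)
  note le = sum_cos_freqs_le[OF *]
  then show "eigenvalue M n f \<le> ground M n" unfolding L G by simp
  assume "eigenvalue M n f = ground M n"
  then have im: "f ` {..<n} = (\<lambda>i. 2 * i + 1) ` {..<n}" using le unfolding L G by simp
  \<comment> \<open>Halving inverts \<open>2 * i + 1\<close>; being the identity beyond
    \<open>n\<close> is what \<open>permutes\<close> demands.\<close>
  define p where "p i = (if i < n then f i div 2 else i)" for i
  have fp: "f i = 2 * p i + 1" "p i < n" if i: "i < n" for i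
  proof -
    have "f i \<in> (\<lambda>i. 2 * i + 1) ` {..<n}" using im i by blast
    then show "f i = 2 * p i + 1" "p i < n" using i by (auto simp: p_def)
  qed
  have "inj_on p {..<n}"
    using assms(2) fp by (auto simp: inj_on_def)
  moreover have "p ` {..<n} \<subseteq> {..<n}" using fp by auto
  ultimately have "bij_betw p {..<n} {..<n}"
    by (simp add: bij_betw_def endo_inj_surj)
  then have "p permutes {..<n}"
    by (rule bij_imp_permutes) (simp add: p_def)
  moreover have "f = ground_tuple n p"
    using f fp by (auto simp: ground_tuple_def fun_eq_iff PiE_def extensional_def)
  ultimately show "f \<in> ground_tuples n" by (auto simp: ground_tuples_def)
qed

section \<open>Reflecting all frequencies\<close>

definition flip :: "nat \<Rightarrow> nat \<Rightarrow> (nat \<Rightarrow> nat) \<Rightarrow> nat \<Rightarrow> nat" where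
  "flip M n f = restrict (\<lambda>i. M - f i) {..<n}"

lemma flip_in_tuples:
  assumes "f \<in> tuples M n"
  shows "flip M n f \<in> tuples M n"
proof -
  obtain e where f: "f \<in> {..<n} \<rightarrow>\<^sub>E freqs M e" using assms by (auto simp: tuples_def)
  \<comment> \<open>The frequencies keep a common parity, which changes exactly when
    \<open>M\<close> is odd.\<close>
  have "M - f i \<in> freqs M (even M = e)" if "i < n" for i
  proof -
    have "f i \<in> freqs M e" using f that by auto
    then show ?thesis by (auto simp: freqs_def even_diff_nat)
  qed
  then show ?thesis by (auto simp: flip_def tuples_def)
qed

lemma tuples_less: "f \<in> tuples M n \<Longrightarrow> i < n \<Longrightarrow> f i < M"
  by (force simp: tuples_def freqs_def)

lemma flip_flip:
  assumes "f \<in> tuples M n"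
  shows "flip M n (flip M n f) = f"
proof -
  have "M - (M - f i) = f i" if "i < n" for i
    using tuples_less[OF assms that] by simp
  moreover have "f i = undefined" if "\<not> i < n" for i
    using assms that by (auto simp: tuples_def PiE_def extensional_def)
  ultimately show ?thesis by (auto simp: flip_def fun_eq_iff)
qed

lemma eigenvalue_flip:
  assumes "f \<in> tuples M n"
  shows "eigenvalue M n (flip M n f) = - eigenvalue M n f"
proof -
  have "cos (pi * real (M - f i) / real M) = - cos (pi * real (f i) / real M)" if "i < n" for i
  proof -
    have "pi * real (M - f i) / real M = pi - pi * real (f i) / real M"
      using tuples_less[OF assms that] by (simp add: of_nat_diff field_simps)
    then show ?thesis by simp
  qed
  then show ?thesis by (simp add: eigenvalue_def flip_def sum_negf)
qed

lemma prod_parity_sign: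
  fixes z :: "nat \<Rightarrow> int"
  shows "(\<Prod>i<n. if even (z i) then 1 else - 1 :: real) = (if even (\<Sum>i<n. z i) then 1 else - 1)"
  by (induction n) auto

text \<open>Row \<open>i\<close> of the determinant and factor \<open>i\<close> of the product each
  pick up a sign; the two cancel exactly when the coordinates \<open>x (Suc i)\<close> and
  \<open>y (Suc i)\<close> have equal parity.\<close>

lemma amplitude_flip:
  assumes "f \<in> tuples M n"
  shows "amplitude M n x y (flip M n f)
    = (if even (\<Sum>i<n. x (Suc i) + y (Suc i)) then 1 else - 1) * amplitude M n x y f"
proof -
  define c :: "int \<Rightarrow> real" where "c a = (if even a then - 1 else 1)" for a
  have *: "sine M (flip M n f i) a = c a * sine M (f i) a" if "i < n" for i a
  proof -
    have "f i \<le> M" "M > 0" using tuples_less[OF assms that] by auto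
    then show ?thesis using that by (simp add: flip_def sine_diff_index c_def)
  qed
  have "mat n n (\<lambda>(i, j). sine M (flip M n f j) (x (Suc i)))
      = mat n n (\<lambda>(i, j). c (x (Suc i)) * sine M (f j) (x (Suc i)))"
    by (intro eq_matI) (auto simp: *)
  then have "sine_det M n (flip M n f) x = (\<Prod>i<n. c (x (Suc i))) * sine_det M n f x"
    by (simp only: sine_det_def det_scale_rows)
  moreover have "(\<Prod>i<n. sine M (flip M n f i) (y (Suc i)))
      = (\<Prod>i<n. c (y (Suc i))) * (\<Prod>i<n. sine M (f i) (y (Suc i)))"
    by (simp add: * prod.distrib)
  ultimately have "amplitude M n x y (flip M n f)
      = (\<Prod>i<n. c (x (Suc i)) * c (y (Suc i))) * amplitude M n x y f"
    by (simp add: amplitude_def prod.distrib)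
  also have "(\<Prod>i<n. c (x (Suc i)) * c (y (Suc i)))
      = (\<Prod>i<n. if even (x (Suc i) + y (Suc i)) then 1 else - 1)"
    by (intro prod.cong) (auto simp: c_def)
  finally show ?thesis unfolding prod_parity_sign .
qed

section \<open>Leading term and remainder\<close>

definition ground_state :: "nat \<Rightarrow> nat \<Rightarrow> (nat \<Rightarrow> int) \<Rightarrow> real" where
  "ground_state M n x = sine_det M n (\<lambda>i. 2 * i + 1) x"

text \<open>Permuting the columns pulls the sign of \<open>p\<close> out of the determinant at
  \<open>x\<close>; these signs turn the products at \<open>y\<close> into the Leibniz expansion of
  a second determinant.\<close>

lemma sum_amplitude_ground_tuples:
  "(\<Sum>f\<in>ground_tuples n. amplitude M n x y f) = ground_state M n x * ground_state M n y"
proof -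
  have "sine_det M n (ground_tuple n p) x = signof p * ground_state M n x" if p: "p permutes {..<n}" for p
  proof -
    have "ground_state M n x
      = (\<Sum>q | q permutes {..<n}. signof (p \<circ> q) * (\<Prod>i<n. sine M (2 * (p \<circ> q) i + 1) (x (Suc i))))"
      unfolding ground_state_def sine_det_leibniz by (rule setum_permutations_compose_left[OF p])
    also have "\<dots> = (\<Sum>q | q permutes {..<n}. signof p * (signof q *
        (\<Prod>i<n. sine M (ground_tuple n p (q i)) (x (Suc i)))))"
    proof (intro sum.cong refl)
      fix q assume "q \<in> {q. q permutes {..<n}}"
      then have q: "q permutes {..<n}" by simp
      have "signof (p \<circ> q) = (signof p * signof q :: real)"
        using sign_compose[OF permutes_imp_permutation[OF _ p] permutes_imp_permutation[OF _ q]] by simp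
      moreover have "q i < n" if "i < n" for i using permutes_in_image[OF q] that by simp
      ultimately show "signof (p \<circ> q) * (\<Prod>i<n. sine M (2 * (p \<circ> q) i + 1) (x (Suc i)))
        = signof p * (signof q * (\<Prod>i<n. sine M (ground_tuple n p (q i)) (x (Suc i))))"
        by (simp add: ground_tuple_def)
    qed
    also have "\<dots> = signof p * sine_det M n (ground_tuple n p) x"
      unfolding sine_det_leibniz sum_distrib_left ..
    finally show ?thesis by (simp add: sign_def)
  qed
  then have "(\<Sum>f\<in>ground_tuples n. amplitude M n x y f)
      = (\<Sum>p | p permutes {..<n}. ground_state M n x * (signof p * (\<Prod>i<n. sine M (2 * p i + 1) (y (Suc i)))))"
    unfolding ground_tuples_def sum.reindex[OF inj_on_ground_tuple]
    by (intro sum.cong refl) (simp add: amplitude_def ground_tuple_def)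
  also have "\<dots> = ground_state M n x * ground_state M n y"
    unfolding sum_distrib_left[symmetric] ground_state_def[of M n y] sine_det_leibniz ..
  finally show ?thesis .
qed

lemma amplitude_nonzero_imp_inj:
  assumes "amplitude M n x y f \<noteq> 0"
  shows "inj_on f {..<n}"
proof (rule inj_onI, rule ccontr)
  fix i j assume "i \<in> {..<n}" "j \<in> {..<n}" "f i = f j" "i \<noteq> j"
  then show False using assms sine_det_eq_0_index[of i n j f M x] by (simp add: amplitude_def)
qed

lemma inj_on_flip_tuple:
  assumes "f \<in> tuples M n" "inj_on f {..<n}"
  shows "inj_on (flip M n f) {..<n}"
proof (rule inj_onI)
  fix i j assume ij: "i \<in> {..<n}" "j \<in> {..<n}" "flip M n f i = flip M n f j"
  then have "f i < M" "f j < M" using tuples_less[OF assms(1)] by auto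
  then have "f i = f j" using ij by (simp add: flip_def)
  then show "i = j" using assms(2) ij by (simp add: inj_on_def)
qed

text \<open>The lower bound is the upper bound for the reflected tuple. A nonzero amplitude
  guarantees distinct frequencies, as the bound on sets of frequencies requires.\<close>

lemma abs_eigenvalue_le_ground:
  assumes "f \<in> tuples M n" "amplitude M n x y f \<noteq> 0"
  shows "\<bar>eigenvalue M n f\<bar> \<le> ground M n"
    and "f \<notin> ground_tuples n \<Longrightarrow> f \<notin> flip M n ` ground_tuples n \<Longrightarrow> \<bar>eigenvalue M n f\<bar> < ground M n"
proof -
  note inj = amplitude_nonzero_imp_inj[OF assms(2)]
  note f = eigenvalue_le_ground[OF assms(1) inj]
  note f' = eigenvalue_le_ground[OF flip_in_tuples[OF assms(1)] inj_on_flip_tuple[OF assms(1) inj],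
      unfolded eigenvalue_flip[OF assms(1)]]
  show "\<bar>eigenvalue M n f\<bar> \<le> ground M n" using f(1) f'(1) by simp
  assume "f \<notin> ground_tuples n" and *: "f \<notin> flip M n ` ground_tuples n"
  moreover have "flip M n f \<notin> ground_tuples n"
    using * flip_flip[OF assms(1)] by (metis image_eqI)
  ultimately show "\<bar>eigenvalue M n f\<bar> < ground M n" using f f' by linarith
qed

lemma ground_tuples_subset:
  assumes "2 * n \<le> M"
  shows "ground_tuples n \<subseteq> tuples M n"
proof
  fix f assume "f \<in> ground_tuples n"
  then obtain p where p: "p permutes {..<n}" "f = ground_tuple n p"
    by (auto simp: ground_tuples_def)
  have "p i < n" if "i < n" for i using permutes_in_image[OF p(1)] that by simp
  then have "2 * p i + 1 \<in> freqs M False" if "i < n" for i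
    using that assms by (force simp: freqs_def)
  then have "f \<in> {..<n} \<rightarrow>\<^sub>E freqs M False" by (auto simp: p(2) ground_tuple_def)
  then show "f \<in> tuples M n" by (auto simp: tuples_def)
qed

text \<open>For \<open>k\<close> of the right parity the sign of the negated eigenvalue's power
  cancels the sign of the reflected amplitude, so the ground tuples and their reflections contribute
  equally.\<close>

lemma spectral_sum_split:
  assumes "n \<ge> 1" "2 * n \<le> M" "ground M n > 0" "even (int k + (\<Sum>i<n. x (Suc i) + y (Suc i)))"
  shows "spectral_sum M n k x y = 2 * (ground_state M n x * ground_state M n y) * ground M n ^ k
    + (\<Sum>f\<in>tuples M n - (ground_tuples n \<union> flip M n ` ground_tuples n).
         eigenvalue M n f ^ k * amplitude M n x y f)"
proof -
  let ?G = "ground_tuples n" and ?t = "\<lambda>f. eigenvalue M n f ^ k * amplitude M n x y f"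
  note sub = ground_tuples_subset[OF assms(2)]
  \<comment> \<open>A common element would have both \<open>ground M n\<close> and its negative as
    eigenvalue.\<close>
  have "?G \<inter> flip M n ` ?G = {}"
  proof (rule equals0I)
    fix f assume "f \<in> ?G \<inter> flip M n ` ?G"
    then obtain g where "f \<in> ?G" "g \<in> ?G" "f = flip M n g" by auto
    then have "ground M n = - ground M n"
      using sub by (metis eigenvalue_flip ground_tuple_eigenvalue subsetD)
    then show False using assms(3) by simp
  qed
  have fin: "finite ?G" using sub finite_subset finite_tuples by blast
  have flip_sub: "flip M n ` ?G \<subseteq> tuples M n" using sub flip_in_tuples by blast
  have inj: "inj_on (flip M n) ?G"
    using sub by (intro inj_on_inverseI[of _ "flip M n"]) (auto simp: flip_flip)
  have t_flip: "?t (flip M n f) = ?t f" if "f \<in> tuples M n" for f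
    using assms(4) by (auto simp: eigenvalue_flip[OF that] amplitude_flip[OF that] power_minus_even power_minus_odd)
  have G: "(\<Sum>f\<in>?G. ?t f) = ground_state M n x * ground_state M n y * ground M n ^ k"
    unfolding sum_amplitude_ground_tuples[symmetric] sum_distrib_right
    by (intro sum.cong refl) (simp add: ground_tuple_eigenvalue)
  moreover have "(\<Sum>f\<in>flip M n ` ?G. ?t f) = (\<Sum>f\<in>?G. ?t f)"
    unfolding sum.reindex[OF inj] comp_def by (intro sum.cong refl t_flip) (use sub in auto)
  moreover have "(\<Sum>f\<in>tuples M n. ?t f)
      = (\<Sum>f\<in>tuples M n - (?G \<union> flip M n ` ?G). ?t f) + (\<Sum>f\<in>?G \<union> flip M n ` ?G. ?t f)"
    by (rule sum.subset_diff) (use sub flip_sub in auto)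
  moreover have "(\<Sum>f\<in>?G \<union> flip M n ` ?G. ?t f) = (\<Sum>f\<in>?G. ?t f) + (\<Sum>f\<in>flip M n ` ?G. ?t f)"
    by (rule sum.union_disjoint) (use fin \<open>?G \<inter> _ = {}\<close> in auto)
  ultimately show ?thesis unfolding spectral_sum_tuples[OF assms(1)] by simp
qed

lemma spectral_sum_remainder:
  assumes "ground M n > 0"
  shows "(\<lambda>k. (\<Sum>f\<in>tuples M n - (ground_tuples n \<union> flip M n ` ground_tuples n).
         eigenvalue M n f ^ k * amplitude M n x y f) / ground M n ^ k) \<longlonglongrightarrow> 0"
  unfolding sum_divide_distrib
proof (rule tendsto_null_sum)
  fix f assume f: "f \<in> tuples M n - (ground_tuples n \<union> flip M n ` ground_tuples n)"
  show "(\<lambda>k. eigenvalue M n f ^ k * amplitude M n x y f / ground M n ^ k) \<longlonglongrightarrow> 0"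
  proof (cases "amplitude M n x y f = 0")
    case False
    then have "\<bar>eigenvalue M n f\<bar> < ground M n" using abs_eigenvalue_le_ground f by auto
    then have "\<bar>eigenvalue M n f / ground M n\<bar> < 1" using assms by simp
    then have "(\<lambda>k. (eigenvalue M n f / ground M n) ^ k * amplitude M n x y f) \<longlonglongrightarrow> 0"
      by (intro tendsto_mult_left_zero LIMSEQ_power_zero) simp
    then show ?thesis by (simp add: power_divide)
  qed simp
qed

section \<open>Asymptotics\<close>

lemma ground_closed_form:
  assumes "M \<ge> 2"
  shows "ground M n = sin (2 * real n * (pi / real M)) / sin (pi / real M)"
proof -
  have "pi / real M < pi" using assms by (simp add: field_simps)
  then have "sin (pi / real M) > 0" using assms by (intro sin_gt_zero) auto
  moreover have "ground M n = (\<Sum>i<n. 2 * cos (real (2 * i + 1) * (pi / real M)))"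
    unfolding ground_def eigenvalue_def
    by (intro sum.cong refl arg_cong2[where f = "(*)"] arg_cong[where f = cos]) (simp add: field_simps)
  ultimately show ?thesis using sum_cos_odd_multiples[of "pi / real M" n] by (simp add: field_simps)
qed

text \<open>The size bound keeps the angle in the numerator within \<open>[0, pi]\<close>. The end
  point, \<open>M = 2 * n\<close>, gives the value zero.\<close>

lemma ground_nonneg:
  assumes "M \<ge> 2" "2 * n \<le> M"
  shows "ground M n \<ge> 0"
proof -
  have "2 * real n \<le> real M" using assms(2) by linarith
  then have "2 * real n * (pi / real M) \<le> pi" using assms by (simp add: field_simps)
  moreover have "pi / real M \<le> pi" using assms by (simp add: field_simps)
  ultimately show ?thesis unfolding ground_closed_form[OF assms(1)]
    by (intro divide_nonneg_nonneg sin_ge_zero) auto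
qed

text \<open>Positive and strictly decreasing integers grow from the last one backwards, so the first
  is at least \<open>n\<close> and the second at least \<open>n - 1\<close>, while their sum is
  below \<open>M\<close>.\<close>

lemma int_alcove_size:
  assumes x: "x \<in> int_alcove n M" and "n \<ge> 1"
  shows "2 * n \<le> M"
proof -
  have ge: "int j + 1 \<le> x (Suc (n - 1 - j))" if "j < n" for j
    using that
  proof (induction j)
    case 0
    then show ?case using int_alcove_pos[OF x, of "n - 1"] by simp
  next
    case (Suc j)
    then have "x (Suc (n - 1 - j)) < x (Suc (n - 1 - Suc j))"
      by (intro int_alcove_decreasing[OF x]) auto
    then show ?case using Suc by simp
  qed
  show ?thesis
  proof (cases "n = 1")
    case True
    then show ?thesis using int_alcove_pos[OF x, of 0] int_alcove_less[OF x, of 0] by simp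
  next
    case False
    then have "x (Suc 0) + x (Suc 1) < int M" using \<open>n \<ge> 1\<close> by (intro int_alcove_add_less[OF x]) auto
    moreover have "int n \<le> x (Suc 0)" using ge[of "n - 1"] \<open>n \<ge> 1\<close> by (simp add: of_nat_diff)
    moreover have "n - 1 - (n - 2) = 1" using False \<open>n \<ge> 1\<close> by linarith
    then have "int n - 1 \<le> x (Suc 1)" using ge[of "n - 2"] False \<open>n \<ge> 1\<close> by (simp add: of_nat_diff)
    ultimately show ?thesis by linarith
  qed
qed

definition sine_product :: "nat \<Rightarrow> nat \<Rightarrow> (nat \<Rightarrow> int) \<Rightarrow> real" where
  "sine_product M n x = (\<Prod>i<n. sin (pi * of_int (x (Suc i)) / real M)) *
     (\<Prod>j<n. \<Prod>i<j. sin (pi * of_int (x (Suc i) + x (Suc j)) / real M)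
        * sin (pi * of_int (x (Suc i) - x (Suc j)) / real M))"

lemma prod_pow_pairs: "(\<Prod>j<n. \<Prod>i<j. c * F i j :: real) = c ^ (\<Sum>j<n. j) * (\<Prod>j<n. \<Prod>i<j. F i j)"
  by (simp add: prod.distrib power_sum)

text \<open>The determinant evaluation leaves one factor \<open>4\<close> for each pair of
  coordinates.\<close>

lemma ground_state_eq_sine_product: "ground_state M n x = 4 ^ (\<Sum>j<n. j) * sine_product M n x"
proof -
  let ?y = "\<lambda>i. pi * of_int (x (Suc i)) / real M"
  have "ground_state M n x = det (mat n n (\<lambda>(i, j). sin (real (2 * j + 1) * ?y i)))"
    unfolding ground_state_def sine_det_def sine_def by (simp add: mult_ac)
  also have "\<dots> = (\<Prod>i<n. sin (?y i)) * (\<Prod>j<n. \<Prod>i<j. 4 * (sin (?y i + ?y j) * sin (?y i - ?y j)))"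
    by (rule det_sin_odd_multiples)
  finally show ?thesis unfolding prod_pow_pairs sine_product_def
    by (simp add: add_divide_distrib diff_divide_distrib algebra_simps)
qed

lemma sin_pos_int: "0 < a \<Longrightarrow> a < int M \<Longrightarrow> sin (pi * of_int a / real M) > 0"
proof (rule sin_gt_zero)
  assume "0 < a" "a < int M"
  then have "real_of_int a < real M" "real M > 0" by linarith+
  then show "0 < pi * of_int a / real M" "pi * of_int a / real M < pi"
    using \<open>0 < a\<close> by (auto simp: field_simps)
qed

text \<open>In the alcove all the angles lie strictly between \<open>0\<close> and
  \<open>pi\<close>. This makes the leading coefficient nonzero.\<close>

lemma sine_product_pos:
  assumes x: "x \<in> int_alcove n M"
  shows "sine_product M n x > 0"
proof -
  have "0 < sin (pi * of_int (x (Suc i) + x (Suc j)) / real M) * sin (pi * of_int (x (Suc i) - x (Suc j)) / real M)"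
    if "i < j" "j < n" for i j
  proof -
    have "i < n" using that by simp
    show ?thesis
      using int_alcove_add_less[OF x that] int_alcove_decreasing[OF x that] int_alcove_pos[OF x \<open>i < n\<close>]
        int_alcove_pos[OF x \<open>j < n\<close>] int_alcove_less[OF x \<open>i < n\<close>]
      by (intro mult_pos_pos sin_pos_int) auto
  qed
  then have "0 < (\<Prod>j<n. \<Prod>i<j. sin (pi * of_int (x (Suc i) + x (Suc j)) / real M)
      * sin (pi * of_int (x (Suc i) - x (Suc j)) / real M))"
    by (intro prod_pos) simp
  moreover have "0 < (\<Prod>i<n. sin (pi * of_int (x (Suc i)) / real M))"
    by (intro prod_pos sin_pos_int int_alcove_pos[OF x] int_alcove_less[OF x]) simp_all
  ultimately show ?thesis unfolding sine_product_def by simp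
qed

lemma sine_product_mult:
  "sine_product M n x * sine_product M n y =
     (\<Prod>(h, t)\<in>{(h, t). 1 \<le> h \<and> h < t \<and> t \<le> n}.
        sin (pi * of_int (x h - x t) / real M) * sin (pi * of_int (y h - y t) / real M) *
        sin (pi * of_int (x h + x t) / real M) * sin (pi * of_int (y h + y t) / real M)) *
     (\<Prod>h=1..n. sin (pi * of_int (x h) / real M) * sin (pi * of_int (y h) / real M))"
proof -
  let ?s = "\<lambda>a. sin (pi * real_of_int a / real M)"
  have "(\<Prod>h=1..n. ?s (x h) * ?s (y h)) = (\<Prod>i<n. ?s (x (Suc i)) * ?s (y (Suc i)))"
    by (rule prod.reindex_bij_witness[of _ Suc "\<lambda>h. h - 1"]) auto
  moreover have "(\<Prod>(h, t)\<in>{(h, t). 1 \<le> h \<and> h < t \<and> t \<le> n}. ?s (x h - x t) * ?s (y h - y t) * ?s (x h + x t) * ?s (y h + y t))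
      = (\<Prod>(j, i)\<in>(SIGMA j:{..<n}. {..<j}). ?s (x (Suc i) - x (Suc j)) * ?s (y (Suc i) - y (Suc j))
          * ?s (x (Suc i) + x (Suc j)) * ?s (y (Suc i) + y (Suc j)))"
    by (rule prod.reindex_bij_witness[of _ "\<lambda>(j, i). (Suc i, Suc j)" "\<lambda>(h, t). (t - 1, h - 1)"]) auto
  moreover have "\<dots> = (\<Prod>j<n. \<Prod>i<j. ?s (x (Suc i) - x (Suc j)) * ?s (y (Suc i) - y (Suc j))
          * ?s (x (Suc i) + x (Suc j)) * ?s (y (Suc i) + y (Suc j)))"
    by (subst prod.Sigma) auto
  ultimately show ?thesis unfolding sine_product_def by (simp only: prod.distrib mult_ac)
qed

text \<open>Collects the powers of \<open>4\<close> from the normalisation and from the two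
  determinants.\<close>

lemma four_pow_square: "4 ^ n * (4 ^ (\<Sum>j<n. j)) ^ 2 = (4 ^ (n\<^sup>2) :: real)"
proof -
  have "n + (\<Sum>j<n. j) * 2 = n\<^sup>2" by (induction n) (auto simp: power2_eq_square)
  then show ?thesis by (metis power_add power_mult)
qed

text \<open>If the largest modulus is zero, every eigenvalue with nonzero amplitude is zero.\<close>

lemma spectral_sum_eq_0:
  assumes "n \<ge> 1" "ground M n = 0" "k > 0"
  shows "spectral_sum M n k x y = 0"
proof -
  have "eigenvalue M n f ^ k * amplitude M n x y f = 0" if f: "f \<in> tuples M n" for f
    using abs_eigenvalue_le_ground(1)[OF f, of x y] assms
    by (cases "amplitude M n x y f = 0") auto
  then show ?thesis unfolding spectral_sum_tuples[OF assms(1)] by (intro sum.neutral ballI)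
qed

section \<open>Passage to the limit\<close>

lemma spectral_sum_asymp_equiv:
  assumes "n \<ge> 1" and x: "x \<in> int_alcove n M" and y: "y \<in> int_alcove n M"
    and pos: "ground M n > 0"
  shows "(\<lambda>k. spectral_sum M n k x y)
      \<sim>[inf sequentially (principal {k. even (int k + (\<Sum>i<n. x (Suc i) + y (Suc i)))})]
      (\<lambda>k. 2 * (ground_state M n x * ground_state M n y) * ground M n ^ k)"
proof -
  define c where "c = 2 * (ground_state M n x * ground_state M n y)"
  define R where "R k = (\<Sum>f\<in>tuples M n - (ground_tuples n \<union> flip M n ` ground_tuples n).
         eigenvalue M n f ^ k * amplitude M n x y f)" for k
  have "c > 0" unfolding c_def ground_state_eq_sine_product
    by (intro mult_pos_pos sine_product_pos x y) auto
  have "(\<lambda>k. 1 + R k / ground M n ^ k / c) \<longlonglongrightarrow> 1 + 0 / c"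
    unfolding R_def using \<open>c > 0\<close> by (intro tendsto_intros spectral_sum_remainder pos) auto
  moreover have "(c * ground M n ^ k + R k) / (c * ground M n ^ k) = 1 + R k / ground M n ^ k / c" for k
    using pos \<open>c > 0\<close> by (simp add: field_simps)
  ultimately have "(\<lambda>k. c * ground M n ^ k + R k) \<sim>[sequentially] (\<lambda>k. c * ground M n ^ k)"
    by (intro asymp_equivI') simp
  then have "(\<lambda>k. c * ground M n ^ k + R k)
      \<sim>[inf sequentially (principal {k. even (int k + (\<Sum>i<n. x (Suc i) + y (Suc i)))})]
      (\<lambda>k. c * ground M n ^ k)"
    unfolding asymp_equiv_def by (rule tendsto_mono[OF inf_le1])
  \<comment> \<open>The equivalence above holds along all \<open>k\<close>; the parity condition
    enters only in identifying its left side with the spectral sum.\<close>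
  moreover have "\<forall>\<^sub>F k in inf sequentially (principal {k. even (int k + (\<Sum>i<n. x (Suc i) + y (Suc i)))}).
      spectral_sum M n k x y = c * ground M n ^ k + R k"
    unfolding eventually_inf_principal c_def R_def
    by (intro always_eventually allI impI spectral_sum_split assms(1) int_alcove_size[OF x] pos) simp
  ultimately show "(\<lambda>k. spectral_sum M n k x y)
      \<sim>[inf sequentially (principal {k. even (int k + (\<Sum>i<n. x (Suc i) + y (Suc i)))})]
      (\<lambda>k. 2 * (ground_state M n x * ground_state M n y) * ground M n ^ k)"
    unfolding c_def[symmetric] by (subst asymp_equiv_cong[OF _ always_eventually]) auto
qed

theorem theorem25:
  fixes n :: nat and m :: real and \<eta> \<mu> :: "nat \<Rightarrow> int"
  assumes "n \<ge> 1"
    and "m > 0" and "m \<in> \<int> \<or> half_integer m"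
    and "real_vec \<eta> \<in> alcove_B n m"
    and "real_vec \<mu> \<in> alcove_B n m"
  shows
    "(\<lambda>k. real (card (walks n (alcove_B n m) (real_vec \<eta>) (real_vec \<mu>) k)))
       \<sim>[inf sequentially (principal {k. [int k = coord_sum n \<eta> + coord_sum n \<mu>] (mod 2)})]
     (\<lambda>k. 4 ^ (n\<^sup>2) / (2 * m) ^ n * (sin (of_nat n * pi / m) / sin (pi / (2 * m))) ^ k *
        (\<Prod>(h, t)\<in>{(h, t). 1 \<le> h \<and> h < t \<and> t \<le> n}.
           sin (pi * of_int (\<eta> h - \<eta> t) / (2 * m)) * sin (pi * of_int (\<mu> h - \<mu> t) / (2 * m)) *
           sin (pi * of_int (\<eta> h + \<eta> t) / (2 * m)) * sin (pi * of_int (\<mu> h + \<mu> t) / (2 * m))) *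
        (\<Prod>h=1..n. sin (pi * of_int (\<eta> h) / (2 * m)) * sin (pi * of_int (\<mu> h) / (2 * m))))"
proof -
  have "\<exists>z::int. 2 * m = of_int z"
  proof (cases "m \<in> \<int>")
    case True
    then obtain z where "m = of_int z" by (auto elim: Ints_cases)
    then have "2 * m = of_int (2 * z)" by simp
    then show ?thesis by blast
  next
    case False
    then obtain j :: int where "m = of_int j / 2" using assms(3) by (auto simp: half_integer_def)
    then have "2 * m = of_int j" by simp
    then show ?thesis by blast
  qed
  then obtain z :: int where "2 * m = of_int z" by blast
  define M where "M = nat z"
  have M: "2 * m = real M" using \<open>2 * m = of_int z\<close> \<open>m > 0\<close> by (simp add: M_def)
  have \<eta>: "\<eta> \<in> int_alcove n M" and \<mu>: "\<mu> \<in> int_alcove n M"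
    using assms real_vec_in_alcove_B_iff[OF M] by auto
  have size: "2 * n \<le> M" by (rule int_alcove_size[OF \<eta> assms(1)])
  then have "M \<ge> 2" using assms(1) by linarith
  \<comment> \<open>The claimed expression in the shape in which the exact count delivers it, before
    the constants are collected.\<close>
  define E where "E k = (4 / real M) ^ n / 2 *
      (2 * (ground_state M n \<eta> * ground_state M n \<mu>) * ground M n ^ k)" for k
  have ground: "sin (of_nat n * pi / m) / sin (pi / real M) = ground M n"
  proof -
    have "of_nat n * pi / m = 2 * real n * (pi / real M)"
      unfolding M[symmetric] using \<open>m > 0\<close> by (simp add: field_simps)
    then show ?thesis by (simp only: ground_closed_form[OF \<open>M \<ge> 2\<close>])
  qed
  have "(4 / real M) ^ n / 2 * (2 * (ground_state M n \<eta> * ground_state M n \<mu>) * L)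
      = 4 ^ (n\<^sup>2) / real M ^ n * L * (sine_product M n \<eta> * sine_product M n \<mu>)" for L
    unfolding ground_state_eq_sine_product four_pow_square[symmetric]
    by (simp add: power_divide power2_eq_square)
  then have E: "4 ^ (n\<^sup>2) / (2 * m) ^ n * (sin (of_nat n * pi / m) / sin (pi / (2 * m))) ^ k *
        (\<Prod>(h, t)\<in>{(h, t). 1 \<le> h \<and> h < t \<and> t \<le> n}.
           sin (pi * of_int (\<eta> h - \<eta> t) / (2 * m)) * sin (pi * of_int (\<mu> h - \<mu> t) / (2 * m)) *
           sin (pi * of_int (\<eta> h + \<eta> t) / (2 * m)) * sin (pi * of_int (\<mu> h + \<mu> t) / (2 * m))) *
        (\<Prod>h=1..n. sin (pi * of_int (\<eta> h) / (2 * m)) * sin (pi * of_int (\<mu> h) / (2 * m))) = E k" for k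
    unfolding M ground E_def sine_product_mult by (simp only: mult.assoc)
  have "coord_sum n \<eta> + coord_sum n \<mu> = (\<Sum>i=1..n. \<eta> i + \<mu> i)"
    by (simp add: coord_sum_def sum.distrib)
  also have "\<dots> = (\<Sum>i<n. \<eta> (Suc i) + \<mu> (Suc i))"
    by (rule sum.reindex_bij_witness[of _ Suc "\<lambda>h. h - 1"]) auto
  finally have "[int k = coord_sum n \<eta> + coord_sum n \<mu>] (mod 2)
      \<longleftrightarrow> even (int k + (\<Sum>i<n. \<eta> (Suc i) + \<mu> (Suc i)))" for k
    by (simp add: cong_iff_dvd_diff)
  then have par: "{k. [int k = coord_sum n \<eta> + coord_sum n \<mu>] (mod 2)}
      = {k. even (int k + (\<Sum>i<n. \<eta> (Suc i) + \<mu> (Suc i)))}"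
    by simp
  show ?thesis unfolding E card_walks_alcove_B[OF M assms(1) \<eta> \<mu>] par
  proof (cases "ground M n = 0")
    case True
    \<comment> \<open>Degenerate case: both sides vanish for every \<open>k > 0\<close>, and
      asymptotic equivalence counts \<open>0 / 0\<close> as ratio \<open>1\<close>.\<close>
    have "\<forall>\<^sub>F k in sequentially. (4 / real M) ^ n / 2 * spectral_sum M n k \<eta> \<mu> = E k"
      using eventually_gt_at_top[of 0]
    proof eventually_elim
      case (elim k)
      then show ?case
        using True by (simp add: spectral_sum_eq_0[OF assms(1) True] E_def)
    qed
    then show "(\<lambda>k. (4 / real M) ^ n / 2 * spectral_sum M n k \<eta> \<mu>)
      \<sim>[inf sequentially (principal {k. even (int k + (\<Sum>i<n. \<eta> (Suc i) + \<mu> (Suc i)))})] E"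
      by (intro asymp_equiv_refl_ev filter_leD[OF inf_le1])
  next
    case False
    then have "ground M n > 0" using ground_nonneg[OF \<open>M \<ge> 2\<close> size] by simp
    then show "(\<lambda>k. (4 / real M) ^ n / 2 * spectral_sum M n k \<eta> \<mu>)
      \<sim>[inf sequentially (principal {k. even (int k + (\<Sum>i<n. \<eta> (Suc i) + \<mu> (Suc i)))})] E"
      unfolding E_def by (intro asymp_equiv_mult asymp_equiv_refl spectral_sum_asymp_equiv assms(1) \<eta> \<mu>)
  qed
qed

end
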